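(* Let $P$, the sub-domains $\Pi_I$, the piecewise Hölder function $k$, the wavenumber $k_0>0$, the point $x_0\notin\overline P$, the kernel $G$ and the incident field $u_0$ be as in the context. Suppose the integral equation $$u(x)-\int_P (k^2(y)-k_0^2)\,G(x,y)\,u(y)\,dy=u_0(x),\qquad x\in P,$$ has a solution $u\in L_2(P)$. Extend $u$ outside $P$ by $$u(x)=u_0(x)+\int_P (k^2(y)-k_0^2)\,G(x,y)\,u(y)\,dy,\qquad x\in\mathbb R^3\setminus(P\cup\{x_0\}).$$ Then the extended total field satisfies the smoothness conditions $$u\in C^1(\mathbb R^3\setminus\{x_0\})\ \cap\ \bigcap_I C^2(\Pi_I)\ \cap\ C^2(\mathbb R^3\setminus(\overline P\cup\{x_0\})).$$
   Context: $P=\{x\in\mathbb R^3: a_j<x_j<b_j,\ j=1,2,3\}$ is an open rectangular parallelepiped. For a fixed integer $n\ge1$ set $x_{j,i}=a_j+\frac{b_j-a_j}{n}i$ ($0\le i\le n$), and for a multi-index $I=(i_1,i_2,i_3)$ with $0\le i_1,i_2,i_3\le n-1$ let $\Pi_I=\{x: x_{j,i_j}<x_j<x_{j,i_j+1},\ j=1,2,3\}$, with indicator function $\chi_I$. The complex-valued function $k$ on $P$ is piecewise Hölder: $k=\sum_I k_I\chi_I$ with $k_I\in C^{0,\alpha}(\Pi_I)$ for some $\alpha\in(0,1]$ (Hölder continuous on $\Pi_I$, uniformly, so that it has one-sided limits on the faces; values on the faces between sub-domains are immaterial). The homogeneous medium outside $P$ has wavenumber $k_0>0$. $G(x,y)=\dfrac{e^{ik_0|x-y|}}{4\pi|x-y|}$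 and $u_0(x)=G(x,x_0)=\dfrac{e^{ik_0|x-x_0|}}{4\pi|x-x_0|}$ with a fixed $x_0\notin\overline P$. A solution $u\in L_2(P)$ satisfies the equation almost everywhere in $P$; regularity assertions refer, as usual, to the appropriate representative of its $L_2$ class. *)

theory Defs
  imports "HOL-Analysis.Analysis"
begin

definition holder_on :: "real \<Rightarrow> 'a::metric_space set \<Rightarrow> ('a \<Rightarrow> 'b::metric_space) \<Rightarrow> bool" where
  "holder_on \<alpha> S f \<longleftrightarrow>
     (\<exists>C\<ge>0. \<forall>x\<in>S. \<forall>y\<in>S. dist (f x) (f y) \<le> C * dist x y powr \<alpha>)"

(* C^m regularity, meant for open S: the function is differentiable at every point of S and
   all its directional derivatives are of class C^(m-1). *)
primrec Ck_on :: "nat \<Rightarrow> 'a::euclidean_space set \<Rightarrow> ('a \<Rightarrow> 'b::real_normed_vector) \<Rightarrow> bool" where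
  "Ck_on 0 S f \<longleftrightarrow> continuous_on S f"
| "Ck_on (Suc m) S f \<longleftrightarrow>
     (\<forall>x\<in>S. f differentiable (at x)) \<and>
     (\<forall>h. Ck_on m S (\<lambda>x. frechet_derivative f (at x) h))"

definition L2_on :: "'a::euclidean_space set \<Rightarrow> ('a \<Rightarrow> complex) \<Rightarrow> bool" where
  "L2_on S u \<longleftrightarrow>
     set_borel_measurable lebesgue S u \<and>
     set_integrable lebesgue S (\<lambda>x. (cmod (u x))\<^sup>2)"

definition node :: "real^3 \<Rightarrow> real^3 \<Rightarrow> nat \<Rightarrow> 3 \<Rightarrow> nat \<Rightarrow> real" where
  "node a b n j i = a $ j + (b $ j - a $ j) / real n * real i"

definition multi_indices :: "nat \<Rightarrow> (nat^3) set" where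
  "multi_indices n = {I. \<forall>j. I $ j \<le> n - 1}"

definition subdomain :: "real^3 \<Rightarrow> real^3 \<Rightarrow> nat \<Rightarrow> nat^3 \<Rightarrow> (real^3) set" where
  "subdomain a b n I =
     {x. \<forall>j. node a b n j (I $ j) < x $ j \<and> x $ j < node a b n j (I $ j + 1)}"

(* The values of k on the faces of the sub-domains, a null set, are unconstrained. *)
definition piecewise_holder :: "real^3 \<Rightarrow> real^3 \<Rightarrow> nat \<Rightarrow> (real^3 \<Rightarrow> complex) \<Rightarrow> bool" where
  "piecewise_holder a b n k \<longleftrightarrow>
     (\<exists>\<alpha> kI. 0 < \<alpha> \<and> \<alpha> \<le> 1 \<and>
        (\<forall>I\<in>multi_indices n. holder_on \<alpha> (subdomain a b n I) (kI I)) \<and>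
        (\<forall>x\<in>(\<Union>I\<in>multi_indices n. subdomain a b n I).
           k x = (\<Sum>I\<in>multi_indices n. kI I x * indicator (subdomain a b n I) x)))"

definition green :: "real \<Rightarrow> real^3 \<Rightarrow> real^3 \<Rightarrow> complex" where
  "green k0 x y =
     exp (\<i> * of_real (k0 * norm (x - y))) / of_real (4 * pi * norm (x - y))"

definition incident_field :: "real \<Rightarrow> real^3 \<Rightarrow> real^3 \<Rightarrow> complex" where
  "incident_field k0 x0 x = green k0 x x0"

(* Lebesgue rather than Borel measurability matters here: k is arbitrary on a null set and
   u is only an L2 representative, so the integrand need not be Borel measurable. *)
definition volume_potential ::
    "(real^3) set \<Rightarrow> real \<Rightarrow> (real^3 \<Rightarrow> complex) \<Rightarrow> (real^3 \<Rightarrow> complex) \<Rightarrow> real^3 \<Rightarrow> complex" where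
  "volume_potential P k0 k u x =
     (LINT y:P|lebesgue. ((k y)\<^sup>2 - of_real (k0\<^sup>2)) * green k0 x y * u y)"

definition total_field ::
    "(real^3) set \<Rightarrow> real \<Rightarrow> (real^3 \<Rightarrow> complex) \<Rightarrow> real^3 \<Rightarrow> (real^3 \<Rightarrow> complex) \<Rightarrow> real^3 \<Rightarrow> complex" where
  "total_field P k0 k x0 u x =
     (if x \<in> P then u x else incident_field k0 x0 x + volume_potential P k0 k u x)"

end

(*
  Write g(s) = e^(i k sqrt s) / (4 pi sqrt s), so that G(x,y) = g(|x-y|^2), and regularise the kernel by
  G_e(z) = g(e + |z|^2).  This is smooth for e > 0, and its derivatives of order m = 0, 1, 2 are bounded
  by C |z|^(-1-m) uniformly in e.  Potentials with kernel G_e may be differentiated under the integral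
  sign.  As e tends to 0 the first derivatives converge uniformly for a bounded density phi, so its
  potential is C^1.  For a density that is Hoelder continuous near p, choose a C^1 bump function psi with
  psi(p) > 0 and split phi(y) = (phi(y) - c(x) psi(y)) + c(x) psi(y) with c(x) = phi(x)/psi(x): the first
  part is O(|x-y|^alpha) and absorbs the |z|^-3 singularity, and in the second part one derivative is
  moved onto psi.  So the second derivatives converge locally uniformly as well.

  For the theorem, G(x,.) is square integrable on bounded sets, which makes an L2 solution u bounded
  almost everywhere in P; hence v = u_0 + potential is C^1, the density (k^2 - k_0^2) v is Hoelder
  continuous in every sub-domain and zero outside P, and v is C^2 in these sets.
*)
theory Submission
  imports Defs
begin

text \<open>The obstacle is that the second derivatives of G have size |z|^-3, which just fails to
  be integrable in dimension 3, so the twice differentiated potential is not an absolutely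
  convergent integral. Replacing |z|^2 by e + |z|^2 removes the singularity, and e + |z|^2 >= |z|^2
  is what makes the bounds uniform in e. After c(x) psi is subtracted the density vanishes at y = x,
  and the effective order 3 - \<alpha> is integrable. A compactly supported psi, in place of a
  constant on a ball, leaves no boundary integral when a derivative is moved; the move itself is the
  commutativity of convolution. The factor c(x) is frozen before integrating in y, so it is a
  constant in each integral. The bootstrap climbs from L2 to bounded, to C^1, hence to locally
  Hoelder, and to C^2. At each stage the regularity is that of the right-hand side of the equation,
  which is defined at every point and so provides the representative of the L2 class.\<close>

section \<open>Derivatives of uniform limits\<close>

lemma linear_basis_bound:
  fixes T :: "'a::euclidean_space \<Rightarrow> 'b::real_normed_vector"
  assumes "linear T"
  shows "norm (T h) \<le> (\<Sum>b\<in>Basis. norm (T b)) * norm h"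
proof -
  have "T h = (\<Sum>b\<in>Basis. (h \<bullet> b) *\<^sub>R T b)"
    by (subst euclidean_representation[symmetric])
       (simp only: linear_sum[OF assms] linear_scale[OF assms])
  also have "norm \<dots> \<le> (\<Sum>b\<in>Basis. norm h * norm (T b))"
    by (intro order_trans[OF norm_sum] sum_mono) (auto intro!: mult_right_mono Basis_le_norm)
  finally show ?thesis by (simp add: sum_distrib_left mult.commute)
qed

text \<open>\<open>Ck_on\<close> gives continuity of a derivative only direction by direction.
  Compactness bounds each of the finitely many basis directions, and linearity turns this into one
  bound for the operator.\<close>

lemma directional_bound_compact:
  fixes D :: "'c::topological_space \<Rightarrow> 'a::euclidean_space \<Rightarrow> 'b::real_normed_vector"
  assumes "compact S" "\<And>z. z \<in> S \<Longrightarrow> linear (D z)" "\<And>h. continuous_on S (\<lambda>z. D z h)"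
  obtains L where "L \<ge> 0" "\<And>z h. z \<in> S \<Longrightarrow> norm (D z h) \<le> L * norm h"
proof -
  have "\<exists>B. \<forall>z\<in>S. norm (D z b) \<le> B" for b
    using compact_imp_bounded[OF compact_continuous_image[OF assms(3,1)]]
    by (auto simp: bounded_iff)
  then obtain B where B: "\<And>b z. z \<in> S \<Longrightarrow> norm (D z b) \<le> B b" by metis
  show thesis
  proof
    show "(\<Sum>b\<in>Basis. \<bar>B b\<bar>) \<ge> 0" by (simp add: sum_nonneg)
    fix z h assume "z \<in> S"
    have "norm (D z h) \<le> (\<Sum>b\<in>Basis. norm (D z b)) * norm h"
      using \<open>z \<in> S\<close> assms(2) linear_basis_bound by blast
    also have "\<dots> \<le> (\<Sum>b\<in>Basis. \<bar>B b\<bar>) * norm h"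
      using B[OF \<open>z \<in> S\<close>] by (intro mult_right_mono sum_mono) (auto intro: order_trans[OF _ abs_ge_self])
    finally show "norm (D z h) \<le> (\<Sum>b\<in>Basis. \<bar>B b\<bar>) * norm h" .
  qed
qed

lemma linear_limit:
  fixes g :: "'a::real_normed_vector \<Rightarrow> 'b::real_normed_vector"
  assumes "\<And>n::nat. linear (f n)" "\<And>h. (\<lambda>n. f n h) \<longlonglongrightarrow> g h"
  shows "linear g"
proof (rule linearI)
  fix a b :: 'a and c :: real
  have "(\<lambda>n. f n (a + b)) \<longlonglongrightarrow> g a + g b"
    using tendsto_add[OF assms(2) assms(2)] by (simp add: linear_add[OF assms(1)])
  then show "g (a + b) = g a + g b" using assms(2) LIMSEQ_unique by blast
  have "(\<lambda>n. f n (c *\<^sub>R a)) \<longlonglongrightarrow> c *\<^sub>R g a"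
    using tendsto_scaleR[OF tendsto_const assms(2)] by (simp add: linear_scale[OF assms(1)])
  then show "g (c *\<^sub>R a) = c *\<^sub>R g a" using assms(2) LIMSEQ_unique by blast
qed

text \<open>\<open>has_derivative_sequence\<close> wants convergence that is uniform in the operator
  norm, whereas the limits below come one direction at a time. In finite dimension the basis bound
  closes this gap; linearity of \<open>g' x\<close> is inherited from the
  \<open>f' n x\<close>.\<close>

lemma has_derivative_uniform_limit:
  fixes f :: "nat \<Rightarrow> 'a::euclidean_space \<Rightarrow> 'b::banach"
  assumes "open S" "convex S"
    and der: "\<And>n x. x \<in> S \<Longrightarrow> (f n has_derivative f' n x) (at x)"
    and lim: "\<And>x. x \<in> S \<Longrightarrow> (\<lambda>n. f n x) \<longlonglongrightarrow> g x"
    and unif: "\<And>h. uniform_limit S (\<lambda>n x. f' n x h) (\<lambda>x. g' x h) sequentially"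
    and "x \<in> S"
  shows "(g has_derivative g' x) (at x)"
proof -
  have lin: "linear (f' n z)" if "z \<in> S" for n z
    using der[OF that] has_derivative_linear by blast
  have ling: "linear (g' z)" if "z \<in> S" for z
    by (rule linear_limit[OF lin[OF that]]) (rule tendsto_uniform_limitI[OF unif that])
  have "\<forall>\<^sub>F n in sequentially. \<forall>x\<in>S. \<forall>h. norm (f' n x h - g' x h) \<le> e * norm h"
    if "e > 0" for e
  proof -
    \<comment> \<open>The error \<open>e\<close> is shared equally among the basis
      directions.\<close>
    define d where "d = e / DIM('a)"
    have "d > 0" using that by (simp add: d_def)
    have "\<forall>\<^sub>F n in sequentially. \<forall>b\<in>Basis. \<forall>x\<in>S. dist (f' n x b) (g' x b) < d"
      by (intro eventually_ball_finite) (use unif \<open>d > 0\<close> in \<open>auto simp: uniform_limit_iff\<close>)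
    then show ?thesis
    proof eventually_elim
      case (elim n)
      show ?case
      proof (intro ballI allI)
        fix z h assume z: "z \<in> S"
        have "norm (f' n z h - g' z h) \<le> (\<Sum>b\<in>Basis. norm (f' n z b - g' z b)) * norm h"
          by (rule linear_basis_bound[OF linear_compose_sub[OF lin[OF z] ling[OF z]]])
        also have "\<dots> \<le> (\<Sum>b\<in>(Basis::'a set). d) * norm h"
          using elim z by (intro mult_right_mono sum_mono) (auto simp: dist_norm less_imp_le)
        finally show "norm (f' n z h - g' z h) \<le> e * norm h" by (simp add: d_def)
      qed
    qed
  qed
  then have "\<exists>g0. \<forall>x\<in>S. (\<lambda>n. f n x) \<longlonglongrightarrow> g0 x \<and> (g0 has_derivative g' x) (at x within S)"
    using assms by (intro has_derivative_sequence[of S f f' g' x "g x"])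
       (auto intro: has_derivative_at_withinI)
  then obtain g0 where g0: "\<And>x. x \<in> S \<Longrightarrow> (\<lambda>n. f n x) \<longlonglongrightarrow> g0 x"
    "\<And>x. x \<in> S \<Longrightarrow> (g0 has_derivative g' x) (at x within S)" by blast
  \<comment> \<open>The sequence theorem yields some limit function \<open>g0\<close>; uniqueness of
    limits identifies it with \<open>g\<close> on \<open>S\<close>.\<close>
  have "g0 y = g y" if "y \<in> S" for y using g0(1) lim LIMSEQ_unique that by blast
  then have "(g has_derivative g' x) (at x within S)"
    using g0(2)[OF \<open>x \<in> S\<close>] \<open>x \<in> S\<close> has_derivative_transform by metis
  then show ?thesis using at_within_open[OF \<open>x \<in> S\<close> \<open>open S\<close>] by simp
qed

section \<open>Convolution with a continuous kernel\<close>

lemma continuous_bounded_ball: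
  fixes K :: "'a::euclidean_space \<Rightarrow> 'b::real_normed_vector"
  assumes "continuous_on UNIV K"
  obtains B where "B \<ge> 0" "\<And>z. norm z \<le> R \<Longrightarrow> norm (K z) \<le> B"
proof -
  have "bounded (K ` cball 0 R)"
    by (intro compact_imp_bounded compact_continuous_image continuous_on_subset[OF assms]) auto
  then obtain B where "\<And>z. norm z \<le> R \<Longrightarrow> norm (K z) \<le> B"
    unfolding bounded_iff by (metis imageI mem_cball_0)
  then show thesis by (intro that[of "\<bar>B\<bar>"]) (auto intro: order_trans[OF _ abs_ge_self])
qed

text \<open>\<open>K\<close> is bounded only on bounded sets. This suffices because \<phi> vanishes
  beyond radius \<open>R\<close>, so that \<open>x - y\<close> stays in the ball of radius
  \<open>norm x + R\<close>.\<close>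

lemma integrable_convolution:
  fixes K \<phi> :: "'a::euclidean_space \<Rightarrow> complex"
  assumes K: "continuous_on UNIV K" and \<phi>: "integrable lborel \<phi>" "\<And>y. norm y > R \<Longrightarrow> \<phi> y = 0"
  shows "integrable lborel (\<lambda>y. K (x - y) * \<phi> y)"
proof -
  obtain B where B: "B \<ge> 0" "\<And>z. norm z \<le> norm x + R \<Longrightarrow> norm (K z) \<le> B"
    using continuous_bounded_ball[OF K] by blast
  have [measurable]: "K \<in> borel_measurable borel" "\<phi> \<in> borel_measurable borel"
    using K \<phi>(1) by (auto intro: borel_measurable_continuous_onI)
  show ?thesis
  proof (rule Bochner_Integration.integrable_bound)
    show "integrable lborel (\<lambda>y. B * norm (\<phi> y))" using \<phi>(1) by simp
    show "AE y in lborel. norm (K (x - y) * \<phi> y) \<le> norm (B * norm (\<phi> y))"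
    proof (rule AE_I2)
      fix y
      show "norm (K (x - y) * \<phi> y) \<le> norm (B * norm (\<phi> y))"
      proof (cases "norm y > R")
        case False
        then have "norm (x - y) \<le> norm x + R" using norm_triangle_ineq4[of x y] by linarith
        then show ?thesis using B by (simp add: norm_mult mult_right_mono)
      qed (simp add: \<phi>(2))
    qed
  qed measurable
qed

lemma continuous_convolution:
  fixes K \<phi> :: "'a::euclidean_space \<Rightarrow> complex"
  assumes K: "continuous_on UNIV K" and \<phi>: "integrable lborel \<phi>" "\<And>y. norm y > R \<Longrightarrow> \<phi> y = 0"
  shows "continuous_on UNIV (\<lambda>x. \<integral>y. K (x - y) * \<phi> y \<partial>lborel)"
  unfolding continuous_on_sequentially o_def
proof (intro allI ballI impI, elim conjE)
  fix X :: "nat \<Rightarrow> 'a" and x assume X: "X \<longlonglongrightarrow> x"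
  obtain r where r: "\<And>n. norm (X n) \<le> r"
    using convergent_imp_Bseq[of X] X by (auto simp: convergent_def Bseq_def)
  obtain B where B: "B \<ge> 0" "\<And>z. norm z \<le> r + R \<Longrightarrow> norm (K z) \<le> B"
    using continuous_bounded_ball[OF K] by blast
  have [measurable]: "K \<in> borel_measurable borel" "\<phi> \<in> borel_measurable borel"
    using K \<phi>(1) by (auto intro: borel_measurable_continuous_onI)
  show "(\<lambda>n. \<integral>y. K (X n - y) * \<phi> y \<partial>lborel) \<longlonglongrightarrow> (\<integral>y. K (x - y) * \<phi> y \<partial>lborel)"
  proof (rule integral_dominated_convergence)
    show "integrable lborel (\<lambda>y. B * norm (\<phi> y))" using \<phi>(1) by simp
    have "isCont K (x - y)" for y using K by (simp add: continuous_on_eq_continuous_at)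
    then have "(\<lambda>n. K (X n - y)) \<longlonglongrightarrow> K (x - y)" for y
      by (intro isCont_tendsto_compose[of _ K] tendsto_intros X)
    then show "AE y in lborel. (\<lambda>n. K (X n - y) * \<phi> y) \<longlonglongrightarrow> K (x - y) * \<phi> y"
      by (intro AE_I2 tendsto_intros)
    show "AE y in lborel. norm (K (X n - y) * \<phi> y) \<le> B * norm (\<phi> y)" for n
    proof (rule AE_I2)
      fix y
      show "norm (K (X n - y) * \<phi> y) \<le> B * norm (\<phi> y)"
      proof (cases "norm y > R")
        case False
        then have "norm (X n - y) \<le> r + R"
          using norm_triangle_ineq4[of "X n" y] r[of n] by linarith
        then show ?thesis using B by (simp add: norm_mult mult_right_mono)
      qed (simp add: \<phi>(2))
    qed
  qed measurable
qed

text \<open>Dominated convergence for the difference quotient: on the relevant ball \<open>K\<close>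
  is Lipschitz with constant \<open>L\<close>, which also bounds the derivative, so the normalised
  remainder of the integrand is at most \<open>2 * L * norm (\<phi> y)\<close>.\<close>

lemma has_derivative_convolution:
  fixes K \<phi> :: "'a::euclidean_space \<Rightarrow> complex"
  assumes K: "\<And>z. (K has_derivative D z) (at z)" and D: "\<And>h. continuous_on UNIV (\<lambda>z. D z h)"
    and \<phi>: "integrable lborel \<phi>" "\<And>y. norm y > R \<Longrightarrow> \<phi> y = 0"
  shows "((\<lambda>x. \<integral>y. K (x - y) * \<phi> y \<partial>lborel) has_derivative
          (\<lambda>h. \<integral>y. D (x - y) h * \<phi> y \<partial>lborel)) (at x)"
proof -
  have lin: "linear (D z)" for z using K has_derivative_linear by blast
  have contK: "continuous_on UNIV K"
    using K has_derivative_continuous by (force simp: continuous_on_eq_continuous_at)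
  have intD: "integrable lborel (\<lambda>y. D (x - y) h * \<phi> y)" for h
    by (rule integrable_convolution[OF D \<phi>])
  have intK: "integrable lborel (\<lambda>y. K (x - y) * \<phi> y)" for x
    by (rule integrable_convolution[OF contK \<phi>])
  have [measurable]: "K \<in> borel_measurable borel" "\<phi> \<in> borel_measurable borel"
      "(\<lambda>z. D z h) \<in> borel_measurable borel" for h
    using contK D \<phi>(1) by (auto intro: borel_measurable_continuous_onI)
  have "linear (\<lambda>h. \<integral>y. D (x - y) h * \<phi> y \<partial>lborel)"
    by (rule linearI)
      (simp_all add: linear_add[OF lin] linear_scale[OF lin] distrib_right intD)
  then have bl: "bounded_linear (\<lambda>h. \<integral>y. D (x - y) h * \<phi> y \<partial>lborel)"
    by (simp add: linear_conv_bounded_linear)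
  show ?thesis
    unfolding has_derivative_at_within tendsto_at_iff_sequentially o_def
  proof (intro conjI bl allI impI)
    fix X :: "nat \<Rightarrow> 'a" assume "\<forall>n. X n \<in> UNIV - {x}" and X: "X \<longlonglongrightarrow> x"
    then have ne: "X n \<noteq> x" for n by auto
    obtain r where r: "\<And>n. norm (X n) \<le> r"
      using convergent_imp_Bseq[of X] X by (auto simp: convergent_def Bseq_def)
    then have rx: "norm x \<le> r"
      using Lim_bounded[OF tendsto_norm[OF X]] by blast
    obtain L where L: "L \<ge> 0" "\<And>z h. z \<in> cball 0 (r + R) \<Longrightarrow> norm (D z h) \<le> L * norm h"
      using directional_bound_compact[of "cball 0 (r + R)" D] lin D continuous_on_subset
      by (metis compact_cball top_greatest)
    have on: "onorm (D z) \<le> L" if "z \<in> cball 0 (r + R)" for z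
      using L that by (intro onorm_le) auto
    have lip: "norm (K z - K w) \<le> L * norm (z - w)"
      if "z \<in> cball 0 (r + R)" "w \<in> cball 0 (r + R)" for z w
      by (rule differentiable_bound[of "cball 0 (r + R)" K D])
         (use K that on in \<open>auto intro: has_derivative_at_withinI\<close>)
    define rem where "rem n y = ((K (X n - y) - K (x - y) - D (x - y) (X n - x)) /\<^sub>R norm (X n - x)) * \<phi> y" for n y
    have "(\<lambda>n. \<integral>y. rem n y \<partial>lborel) \<longlonglongrightarrow> (\<integral>(y::'a). 0 \<partial>lborel)"
    proof (rule integral_dominated_convergence)
      show "integrable lborel (\<lambda>y. 2 * L * norm (\<phi> y))" using \<phi>(1) by simp
      show "AE y in lborel. (\<lambda>n. rem n y) \<longlonglongrightarrow> 0"
      proof (rule AE_I2)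
        fix y
        have "((\<lambda>z. (K z - K (x - y) - D (x - y) (z - (x - y))) /\<^sub>R norm (z - (x - y))) \<longlongrightarrow> 0) (at (x - y))"
          using K[of "x - y"] unfolding has_derivative_at_within by blast
        moreover have "filterlim (\<lambda>n. X n - y) (at (x - y)) sequentially"
          using ne X by (auto simp: filterlim_at intro!: tendsto_intros)
        ultimately have "(\<lambda>n. (K (X n - y) - K (x - y) - D (x - y) (X n - y - (x - y)))
            /\<^sub>R norm (X n - y - (x - y))) \<longlonglongrightarrow> 0"
          by (rule filterlim_compose)
        then have "(\<lambda>n. ((K (X n - y) - K (x - y) - D (x - y) (X n - x)) /\<^sub>R norm (X n - x)) * \<phi> y) \<longlonglongrightarrow> 0 * \<phi> y"
          by (intro tendsto_mult tendsto_const) simp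
        then show "(\<lambda>n. rem n y) \<longlonglongrightarrow> 0" by (simp add: rem_def)
      qed
      show "AE y in lborel. norm (rem n y) \<le> 2 * L * norm (\<phi> y)" for n
      proof (rule AE_I2)
        fix y
        show "norm (rem n y) \<le> 2 * L * norm (\<phi> y)"
        proof (cases "norm y > R")
          case False
          have nz: "norm (X n - x) > 0" using ne by simp
          have in1: "X n - y \<in> cball 0 (r + R)" "x - y \<in> cball 0 (r + R)"
            using norm_triangle_ineq4[of "X n" y] norm_triangle_ineq4[of x y] r[of n] rx False
            by auto
          have "norm (K (X n - y) - K (x - y) - D (x - y) (X n - x)) \<le>
              norm (K (X n - y) - K (x - y)) + norm (D (x - y) (X n - x))" by (rule norm_triangle_ineq4)
          also have "\<dots> \<le> L * norm (X n - x) + L * norm (X n - x)"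
            using lip[OF in1] L(2)[OF in1(2)] by (intro add_mono) auto
          finally have "norm ((K (X n - y) - K (x - y) - D (x - y) (X n - x)) /\<^sub>R norm (X n - x)) \<le> 2 * L"
            using nz unfolding norm_scaleR by (simp add: inverse_eq_divide pos_divide_le_eq mult.commute mult.left_commute)
          then show ?thesis unfolding rem_def norm_mult by (intro mult_right_mono) auto
        qed (simp add: rem_def \<phi>(2))
      qed
      show "rem n \<in> borel_measurable lborel" for n unfolding rem_def by measurable
    qed simp
    moreover have "(\<integral>y. rem n y \<partial>lborel) = ((\<integral>y. K (X n - y) * \<phi> y \<partial>lborel) - (\<integral>y. K (x - y) * \<phi> y \<partial>lborel)
        - (\<integral>y. D (x - y) (X n - x) * \<phi> y \<partial>lborel)) /\<^sub>R norm (X n - x)" for n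
      using intK intD by (simp add: rem_def left_diff_distrib)
    ultimately show "(\<lambda>n. ((\<integral>y. K (X n - y) * \<phi> y \<partial>lborel) - (\<integral>y. K (x - y) * \<phi> y \<partial>lborel)
        - (\<integral>y. D (x - y) (X n - x) * \<phi> y \<partial>lborel)) /\<^sub>R norm (X n - x)) \<longlonglongrightarrow> 0" by simp
  qed
qed

section \<open>Weakly singular kernels\<close>

lemma cball_measurable [measurable]: "cball (x::'a::euclidean_space) r \<in> sets borel"
  by (simp add: borel_closed)

lemma distr_lborel_minus:
  fixes x :: "'a::euclidean_space"
  shows "distr lborel borel (\<lambda>y. x - y) = lborel"
  using lborel_affine[of "-1" x] by (simp add: density_1)

lemma integral_lborel_minus:
  fixes f :: "'a::euclidean_space \<Rightarrow> 'b::{banach, second_countable_topology}"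
  assumes [measurable]: "f \<in> borel_measurable borel"
  shows "(\<integral>y. f (x - y) \<partial>lborel) = integral\<^sup>L lborel f"
  by (subst (2) distr_lborel_minus[of x, symmetric]) (simp add: integral_distr)

lemma integrable_lborel_minus:
  fixes f :: "'a::euclidean_space \<Rightarrow> 'b::{banach, second_countable_topology}"
  assumes "integrable lborel f"
  shows "integrable lborel (\<lambda>y. f (x - y))"
proof -
  have [measurable]: "f \<in> borel_measurable borel" using assms by auto
  have "integrable (distr lborel borel (\<lambda>y. x - y)) f" using assms distr_lborel_minus[of x] by simp
  then show ?thesis by (subst (asm) integrable_distr_eq) auto
qed

text \<open>Dyadic decomposition. Each shell between the radii \<open>r / 2 ^ Suc n\<close> and
  \<open>r / 2 ^ n\<close> is enlarged to the outer ball and charged with the value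
  \<open>c n\<close> at the inner radius. The volumes then give a geometric series of ratio
  \<open>q\<close>, which is below 1 because \<open>s < DIM('a)\<close>.\<close>

lemma integrable_norm_powr_ball:
  fixes s :: real
  assumes s: "0 \<le> s" "s < DIM('a)"
  shows "integrable lborel (\<lambda>z::'a::euclidean_space. indicator (cball 0 R) z * norm z powr (-s))"
proof (rule integrableI_bounded)
  \<comment> \<open>The maximum with 1 gives a positive outer radius even when \<open>R\<close> is
    not positive.\<close>
  define r where "r = max R 1"
  define c where "c n = (r / 2 ^ Suc n) powr (-s)" for n :: nat
  define V where "V = unit_ball_vol (real (DIM('a)))"
  define q where "q = 2 powr (s - DIM('a))"
  have r: "r > 0" "R \<le> r" by (auto simp: r_def)
  have c0: "c n \<ge> 0" for n by (simp add: c_def)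
  have V0: "V \<ge> 0" by (simp add: V_def)
  have q: "0 < q" "q < 1" using s powr_less_mono[of "s - DIM('a)" 0 2] by (auto simp: q_def)
  have le: "ennreal (norm (indicator (cball 0 R) z * norm z powr (-s)))
      \<le> (\<Sum>n. ennreal (c n) * indicator (cball 0 (r / 2 ^ n)) z)" for z :: 'a
  proof (cases "z = 0 \<or> norm z > R")
    \<comment> \<open>At the origin \<open>0 powr (-s)\<close> is 0, so the integrand vanishes there
      as well.\<close>
    case True
    then show ?thesis by (auto simp: indicator_def)
  next
    case False
    then have z: "norm z > 0" "norm z \<le> r" using r by auto
    then have "\<exists>N. r * (1/2) ^ N < norm z"
      using real_arch_pow_inv[of "norm z / r" "1/2"] r by (auto simp: field_simps)
    \<comment> \<open>\<open>N\<close> belongs to the first dyadic radius below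
      \<open>norm z\<close>. It is a successor because \<open>norm z <= r\<close>, and its
      predecessor \<open>n\<close> numbers the shell of \<open>z\<close>.\<close>
    then obtain N where N: "r * (1/2) ^ N < norm z" "\<And>m. m < N \<Longrightarrow> \<not> r * (1/2) ^ m < norm z"
      using exists_least_iff[of "\<lambda>N. r * (1/2) ^ N < norm z"] by blast
    then obtain n where n: "N = Suc n" using z by (cases N) auto
    have up: "norm z \<le> r / 2 ^ n" using N(2)[of n] n by (simp add: power_divide)
    have lo: "r / 2 ^ Suc n \<le> norm z" using N(1) n by (simp add: power_divide)
    have "norm z powr (-s) \<le> c n"
      unfolding c_def using lo r s by (intro powr_mono2') auto
    then have "ennreal (norm (indicator (cball 0 R) z * norm z powr (-s))) \<le> ennreal (c n) * indicator (cball 0 (r / 2 ^ n)) z"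
      using False up c0 by (auto simp: ennreal_leI)
    also have "\<dots> \<le> (\<Sum>n. ennreal (c n) * indicator (cball 0 (r / 2 ^ n)) z)"
      using sum_le_suminf[of f "{n}" for f :: "nat \<Rightarrow> ennreal"] by simp
    finally show ?thesis .
  qed
  have shell: "c n * (V * (r / 2 ^ n) ^ DIM('a)) = (r powr (-s) * 2 powr s * V * r ^ DIM('a)) * q ^ n" for n
  proof -
    have "(2 ^ Suc n) powr (-s) = inverse ((2 powr s) ^ Suc n)"
      by (subst powr_realpow[symmetric], simp, subst powr_power, simp)
         (simp only: powr_powr powr_minus[symmetric] mult_minus_right mult_minus_left)
    then have "c n = r powr (-s) * (2 powr s) ^ Suc n"
      using r unfolding c_def by (subst powr_divide) (auto simp: divide_inverse)
    moreover have "q ^ n = (2 powr s) ^ n / (2 ^ n) ^ DIM('a)"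
      by (simp add: q_def powr_diff power_divide powr_realpow power_mult[symmetric] mult.commute)
    ultimately show ?thesis by (simp add: power_divide)
  qed
  have "(\<integral>\<^sup>+z. ennreal (norm (indicator (cball 0 R) z * norm z powr (-s))) \<partial>(lborel::'a measure))
      \<le> (\<integral>\<^sup>+z. (\<Sum>n. ennreal (c n) * indicator (cball 0 (r / 2 ^ n)) z) \<partial>(lborel::'a measure))"
    by (intro nn_integral_mono le)
  also have "\<dots> = (\<Sum>n. \<integral>\<^sup>+z. ennreal (c n) * indicator (cball 0 (r / 2 ^ n)) z \<partial>(lborel::'a measure))"
    by (rule nn_integral_suminf) auto
  also have "\<dots> = (\<Sum>n. ennreal (c n * (V * (r / 2 ^ n) ^ DIM('a))))"
    using r c0 V0 by (intro suminf_cong) (simp add: nn_integral_cmult_indicator emeasure_cball V_def ennreal_mult)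
  also have "\<dots> = ennreal (\<Sum>n. (r powr (-s) * 2 powr s * V * r ^ DIM('a)) * q ^ n)"
    unfolding shell using q r V0 by (intro suminf_ennreal2 summable_mult summable_geometric) auto
  also have "\<dots> < \<infinity>" by simp
  finally show "(\<integral>\<^sup>+z. ennreal (norm (indicator (cball 0 R) z * norm z powr (-s))) \<partial>(lborel::'a measure)) < \<infinity>" .
qed measurable

text \<open>A zero of order \<beta> of the density at \<open>x\<close> weakens the pole of order
  \<open>t\<close> to one of order \<open>t - \<beta>\<close>, which has to stay below the
  dimension. The point \<open>y = x\<close> is excluded from both bounds, being a null set.\<close>

lemma integrable_singular_kernel:
  fixes t \<beta> :: real and K :: "'a::euclidean_space \<Rightarrow> complex"
  assumes s: "0 \<le> t - \<beta>" "t - \<beta> < DIM('a)"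
    and [measurable]: "K \<in> borel_measurable borel" "\<Phi> \<in> borel_measurable borel"
    and K: "\<And>z. z \<noteq> 0 \<Longrightarrow> norm z \<le> R \<Longrightarrow> norm (K z) \<le> C * norm z powr (-t)"
    and \<Phi>: "\<And>y. y \<noteq> x \<Longrightarrow> norm (\<Phi> y) \<le> M * norm (x - y) powr \<beta>" "\<And>y. norm (x - y) > R \<Longrightarrow> \<Phi> y = 0"
  shows "integrable lborel (\<lambda>y. K (x - y) * \<Phi> y)"
proof (rule Bochner_Integration.integrable_bound)
  show "integrable lborel (\<lambda>y. C * M * (indicator (cball 0 R) (x - y) * norm (x - y) powr (-(t - \<beta>))))"
    by (intro integrable_mult_right integrable_lborel_minus[OF integrable_norm_powr_ball[OF s]])
  show "AE y in lborel. norm (K (x - y) * \<Phi> y)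
      \<le> norm (C * M * (indicator (cball 0 R) (x - y) * norm (x - y) powr (-(t - \<beta>))))"
    using AE_lborel_singleton[of x]
  proof eventually_elim
    case (elim y)
    show ?case
    proof (cases "norm (x - y) > R")
      case False
      have "norm (K (x - y) * \<Phi> y) \<le> (C * norm (x - y) powr (-t)) * (M * norm (x - y) powr \<beta>)"
        unfolding norm_mult using elim False
        by (intro mult_mono K \<Phi>) (auto intro: order_trans[OF norm_ge_zero K])
      also have "\<dots> = C * M * norm (x - y) powr (-(t - \<beta>))"
        by (simp add: powr_add[symmetric])
      finally show ?thesis using False by (auto intro: order_trans[OF _ abs_ge_self])
    qed (simp add: \<Phi>(2))
  qed
qed measurable

text \<open>After substituting \<open>z = x - y\<close>, the difference of the two integrals is at
  most \<open>M\<close> times the integral of \<open>d n\<close>, in which \<open>x\<close> no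
  longer occurs: this is the source of uniformity. The density may depend on \<open>x\<close>
  because the second-derivative argument subtracts a multiple of the bump that changes with
  \<open>x\<close>.\<close>

lemma singular_kernel_uniform_limit:
  fixes t \<beta> :: real and K :: "'a::euclidean_space \<Rightarrow> complex" and Kn :: "nat \<Rightarrow> 'a \<Rightarrow> complex"
  assumes s: "0 \<le> t - \<beta>" "t - \<beta> < DIM('a)"
    and [measurable]: "\<And>n. Kn n \<in> borel_measurable borel" "K \<in> borel_measurable borel"
       "\<And>x. \<Phi> x \<in> borel_measurable borel"
    and Kn: "\<And>n z. z \<noteq> 0 \<Longrightarrow> norm z \<le> R \<Longrightarrow> norm (Kn n z) \<le> C * norm z powr (-t)"
    and lim: "\<And>z. z \<noteq> 0 \<Longrightarrow> (\<lambda>n. Kn n z) \<longlonglongrightarrow> K z"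
    and \<Phi>: "\<And>x y. x \<in> S \<Longrightarrow> y \<noteq> x \<Longrightarrow> norm (\<Phi> x y) \<le> M * norm (x - y) powr \<beta>"
      "\<And>x y. x \<in> S \<Longrightarrow> norm (x - y) > R \<Longrightarrow> \<Phi> x y = 0"
  shows "uniform_limit S (\<lambda>n x. \<integral>y. Kn n (x - y) * \<Phi> x y \<partial>lborel) (\<lambda>x. \<integral>y. K (x - y) * \<Phi> x y \<partial>lborel) sequentially"
proof -
  have K: "norm (K z) \<le> C * norm z powr (-t)" if "z \<noteq> 0" "norm z \<le> R" for z
    using Lim_bounded[OF tendsto_norm[OF lim[OF that(1)]]] Kn that by blast
  \<comment> \<open>\<open>d n\<close> is the kernel error weighted by the vanishing order of the
    density. The 2 in its majorant \<open>w\<close> comes from bounding \<open>Kn n\<close> and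
    \<open>K\<close> separately.\<close>
  define d where "d n z = indicator (cball 0 R) z * norm z powr \<beta> * norm (Kn n z - K z)" for n and z :: 'a
  define w where "w z = 2 * C * (indicator (cball 0 R) z * norm z powr (-(t - \<beta>)))" for z :: 'a
  have intw: "integrable lborel w"
    unfolding w_def by (intro integrable_mult_right integrable_norm_powr_ball[OF s])
  have [measurable]: "d n \<in> borel_measurable borel" for n unfolding d_def by measurable
  have dw: "norm (d n z) \<le> w z" for n z
  proof (cases "z = 0 \<or> norm z > R")
    case False
    then have "norm (Kn n z - K z) \<le> C * norm z powr (-t) + C * norm z powr (-t)"
      by (intro order_trans[OF norm_triangle_ineq4] add_mono K Kn) auto
    then have "norm z powr \<beta> * norm (Kn n z - K z) \<le> norm z powr \<beta> * (2 * C * norm z powr (-t))"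
      by (intro mult_left_mono) auto
    also have "\<dots> = 2 * C * norm z powr (-(t - \<beta>))"
      by (simp add: powr_add[symmetric])
    finally show ?thesis using False by (simp add: d_def w_def)
  qed (auto simp: d_def w_def)
  have intd: "integrable lborel (d n)" for n
    by (rule Bochner_Integration.integrable_bound[OF intw]) (auto intro: order_trans[OF dw[unfolded real_norm_def] abs_ge_self])
  have "(\<lambda>n. integral\<^sup>L lborel (d n)) \<longlonglongrightarrow> (\<integral>(z::'a). 0 \<partial>lborel)"
  proof (rule integral_dominated_convergence[OF _ _ intw])
    show "AE z in lborel. (\<lambda>n. d n z) \<longlonglongrightarrow> 0"
      using AE_lborel_singleton[of "0::'a"]
    proof eventually_elim
      case (elim z)
      have "(\<lambda>n. indicator (cball 0 R) z * norm z powr \<beta> * norm (Kn n z - K z)) \<longlonglongrightarrow>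
         indicator (cball 0 R) z * norm z powr \<beta> * norm (K z - K z)"
        by (intro tendsto_intros lim elim)
      then show ?case by (simp add: d_def)
    qed
  qed (use dw in auto)
  then have lim0: "(\<lambda>n. M * integral\<^sup>L lborel (d n)) \<longlonglongrightarrow> 0"
    using tendsto_mult_right_zero by auto
  have le: "dist (\<integral>y. Kn n (x - y) * \<Phi> x y \<partial>lborel) (\<integral>y. K (x - y) * \<Phi> x y \<partial>lborel) \<le> M * integral\<^sup>L lborel (d n)"
    if x: "x \<in> S" for n x
  proof -
    have int: "integrable lborel (\<lambda>y. L (x - y) * \<Phi> x y)"
      if "L \<in> borel_measurable borel" "\<And>z. z \<noteq> 0 \<Longrightarrow> norm z \<le> R \<Longrightarrow> norm (L z) \<le> C * norm z powr (-t)" for L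
      by (rule integrable_singular_kernel[OF s that(1) _ that(2)]) (use x \<Phi> in auto)
    note int = int[OF assms(3)[of n] Kn] int[OF assms(4) K]
    have intM: "integrable lborel (\<lambda>y. M * d n (x - y))"
      by (intro integrable_mult_right integrable_lborel_minus intd)
    have "norm (\<integral>y. Kn n (x - y) * \<Phi> x y - K (x - y) * \<Phi> x y \<partial>lborel)
        \<le> (\<integral>y. norm (Kn n (x - y) * \<Phi> x y - K (x - y) * \<Phi> x y) \<partial>lborel)"
      by (rule integral_norm_bound)
    also have "\<dots> \<le> (\<integral>y. M * d n (x - y) \<partial>lborel)"
    proof (rule integral_mono_AE[OF _ intM])
      show "AE y in lborel. norm (Kn n (x - y) * \<Phi> x y - K (x - y) * \<Phi> x y) \<le> M * d n (x - y)"
        using AE_lborel_singleton[of x]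
      proof eventually_elim
        case (elim y)
        have "Kn n (x - y) * \<Phi> x y - K (x - y) * \<Phi> x y = (Kn n (x - y) - K (x - y)) * \<Phi> x y"
          by (simp add: left_diff_distrib)
        also have "norm \<dots> \<le> M * d n (x - y)"
        proof (cases "norm (x - y) > R")
          case False
          have "norm ((Kn n (x - y) - K (x - y)) * \<Phi> x y)
              \<le> norm (Kn n (x - y) - K (x - y)) * (M * norm (x - y) powr \<beta>)"
            unfolding norm_mult using elim x by (intro mult_left_mono \<Phi>) auto
          with False show ?thesis by (simp add: d_def mult.commute mult.left_commute)
        qed (use x in \<open>simp add: \<Phi>(2) d_def\<close>)
        finally show ?case .
      qed
    qed (use int in auto)
    also have "\<dots> = M * integral\<^sup>L lborel (d n)" by (simp add: integral_lborel_minus)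
    finally show ?thesis using int by (simp add: dist_norm)
  qed
  show ?thesis
    unfolding uniform_limit_iff
  proof (intro allI impI)
    fix e :: real assume "e > 0"
    from order_tendstoD(2)[OF lim0 this]
    show "\<forall>\<^sub>F n in sequentially. \<forall>x\<in>S. dist (\<integral>y. Kn n (x - y) * \<Phi> x y \<partial>lborel) (\<integral>y. K (x - y) * \<Phi> x y \<partial>lborel) < e"
      by eventually_elim (use le_less_trans[OF le] in blast)
  qed
qed

section \<open>The regularised Green function\<close>

definition helm :: "real \<Rightarrow> real \<Rightarrow> complex" where
  "helm k s = exp (\<i> * of_real (k * sqrt s)) / of_real (4 * pi * sqrt s)"

definition helm' :: "real \<Rightarrow> real \<Rightarrow> complex" where
  "helm' k s = exp (\<i> * of_real (k * sqrt s)) * (\<i> * of_real (k * sqrt s) - 1) / of_real (8 * pi * sqrt s ^ 3)"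

definition helm'' :: "real \<Rightarrow> real \<Rightarrow> complex" where
  "helm'' k s = exp (\<i> * of_real (k * sqrt s)) * (3 - 3 * \<i> * of_real (k * sqrt s) - of_real ((k * sqrt s)\<^sup>2))
     / of_real (16 * pi * sqrt s ^ 5)"

text \<open>In the variable \<open>r = sqrt s\<close>, \<open>helm\<close> is the restriction of the
  complex function \<open>E\<close> to the positive axis, so complex differentiation and the chain
  rule for \<open>sqrt\<close> give the result.\<close>

lemma helm_has_vector_derivative:
  assumes "s > 0"
  shows "(helm k has_vector_derivative helm' k s) (at s)"
proof -
  define r where "r = sqrt s"
  have r: "r > 0" using assms by (simp add: r_def)
  define E where "E z = exp (\<i> * (of_real k * z)) / (4 * of_real pi * z)" for z :: complex
  define E' where "E' = exp (\<i> * of_real (k * r)) * (\<i> * of_real (k * r) - 1) / (4 * of_real pi * (of_real r)\<^sup>2)"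
  have "(E has_field_derivative E') (at (of_real r))"
    unfolding E_def E'_def using r
    by (auto intro!: derivative_eq_intros simp: field_simps power2_eq_square)
  then have "((\<lambda>r. E (of_real r)) has_vector_derivative E') (at r)"
    by (intro has_vector_derivative_real_field)
  moreover have "(sqrt has_vector_derivative (inverse (sqrt s) / 2)) (at s)"
    using DERIV_real_sqrt[OF assms] by (simp add: has_real_derivative_iff_has_vector_derivative)
  ultimately have "((\<lambda>r. E (of_real r)) \<circ> sqrt has_vector_derivative (inverse (sqrt s) / 2) *\<^sub>R E') (at s)"
    unfolding r_def by (intro vector_diff_chain_at)
  moreover have "(\<lambda>r. E (of_real r)) \<circ> sqrt = helm k" by (auto simp: E_def helm_def fun_eq_iff)
  moreover have "(inverse (sqrt s) / 2) *\<^sub>R E' = helm' k s"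
    unfolding helm'_def E'_def r_def[symmetric] using r
    by (simp add: scaleR_conv_of_real field_simps power2_eq_square power3_eq_cube)
  ultimately show ?thesis by simp
qed

lemma helm'_has_vector_derivative:
  assumes "s > 0"
  shows "(helm' k has_vector_derivative helm'' k s) (at s)"
proof -
  define r where "r = sqrt s"
  define c where "c = \<i> * of_real k"
  define w where "w = complex_of_real r"
  define p where "p = complex_of_real pi"
  have w: "w \<noteq> 0" "p \<noteq> 0" using assms by (auto simp: w_def r_def p_def)
  define E where "E z = exp (c * z) * (c * z - 1) / (8 * p * z ^ 3)" for z
  define N where "N = exp (c * w) * (3 - 3 * (c * w) + (c * w)\<^sup>2)"
  have "((\<lambda>z. exp (c * z) * (c * z - 1)) has_field_derivative exp (c * w) * c * (c * w - 1) + exp (c * w) * c) (at w)"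
    by (auto intro!: derivative_eq_intros)
  moreover have "((\<lambda>z. 8 * p * z ^ 3) has_field_derivative 24 * p * w ^ 2) (at w)"
    by (auto intro!: derivative_eq_intros)
  ultimately have "(E has_field_derivative ((exp (c * w) * c * (c * w - 1) + exp (c * w) * c) * (8 * p * w ^ 3)
      - exp (c * w) * (c * w - 1) * (24 * p * w ^ 2)) / (8 * p * w ^ 3 * (8 * p * w ^ 3))) (at w)"
    unfolding E_def using w by (intro DERIV_divide) auto
  \<comment> \<open>This splits the factor \<open>8 * p * w ^ 2\<close> off the numerator of the
    quotient rule; it is cancelled next. With a variable \<open>x\<close> in place of the
    exponential, only a polynomial identity remains.\<close>
  moreover have "(x * c * (c * w - 1) + x * c) * (8 * p * w ^ 3) - x * (c * w - 1) * (24 * p * w ^ 2)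
      = x * (3 - 3 * (c * w) + (c * w)\<^sup>2) * (8 * p * w ^ 2)" for x by algebra
  moreover have "y * (8 * p * w ^ 2) / (8 * p * w ^ 3 * (8 * p * w ^ 3)) = y / (8 * p * w ^ 4)" for y
    using w by (simp add: frac_eq_eq)
  ultimately have "(E has_field_derivative N / (8 * p * w ^ 4)) (at (of_real r))"
    by (simp only: N_def flip: w_def)
  then have "((\<lambda>r. E (of_real r)) has_vector_derivative N / (8 * p * w ^ 4)) (at r)"
    by (intro has_vector_derivative_real_field)
  moreover have "(sqrt has_vector_derivative (inverse (sqrt s) / 2)) (at s)"
    using DERIV_real_sqrt[OF assms] by (simp add: has_real_derivative_iff_has_vector_derivative)
  ultimately have "((\<lambda>r. E (of_real r)) \<circ> sqrt has_vector_derivative (inverse r / 2) *\<^sub>R (N / (8 * p * w ^ 4))) (at s)"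
    unfolding r_def by (intro vector_diff_chain_at)
  moreover have "(\<lambda>r. E (of_real r)) \<circ> sqrt = helm' k"
    by (auto simp: E_def helm'_def fun_eq_iff c_def p_def mult.assoc)
  moreover have "(inverse r / 2) *\<^sub>R (N / (8 * p * w ^ 4)) = helm'' k s"
  proof -
    have "(inverse r / 2) *\<^sub>R (N / (8 * p * w ^ 4)) = N / (16 * p * (w * w ^ 4))"
    proof -
      have "complex_of_real (inverse r / 2) = 1 / (2 * w)" by (simp add: w_def inverse_eq_divide)
      then show ?thesis unfolding scaleR_conv_of_real by (simp only: times_divide_times_eq) (simp add: mult.left_commute)
    qed
    moreover have "w * w ^ 4 = w ^ 5" using power_Suc[of w 4] by simp
    moreover have "N = exp (\<i> * of_real (k * r)) * (3 - 3 * \<i> * of_real (k * r) - of_real ((k * r)\<^sup>2))"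
      by (simp add: N_def c_def w_def power_mult_distrib mult_ac)
    ultimately show ?thesis by (simp add: helm''_def r_def w_def p_def)
  qed
  ultimately show ?thesis by simp
qed

lemma helm_continuous:
  shows "continuous_on {0<..} (helm k)" "continuous_on {0<..} (helm' k)" "continuous_on {0<..} (helm'' k)"
  unfolding helm_def helm'_def helm''_def by (auto intro!: continuous_intros)

lemma helm_measurable [measurable]:
  shows "helm k \<in> borel_measurable borel" "helm' k \<in> borel_measurable borel" "helm'' k \<in> borel_measurable borel"
proof -
  have [measurable]: "(\<lambda>s::real. exp (\<i> * of_real (k * sqrt s))) \<in> borel_measurable borel"
    by (intro borel_measurable_continuous_onI continuous_intros)
  show "helm k \<in> borel_measurable borel" "helm' k \<in> borel_measurable borel" "helm'' k \<in> borel_measurable borel"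
    unfolding helm_def helm'_def helm''_def by measurable
qed

text \<open>The exponential has modulus 1 because its argument is imaginary. The remaining
  numerators are polynomials in \<open>k * sqrt s\<close>, bounded through
  \<open>sqrt s <= Q\<close>, and the multiples of pi in the denominators are at least 1.\<close>

lemma norm_helm_le:
  assumes "0 < r" "r \<le> sqrt s" "s \<le> Q\<^sup>2" "Q \<ge> 0"
  shows "norm (helm k s) \<le> 1 / sqrt s"
    and "norm (helm' k s) \<le> (\<bar>k\<bar> * Q + 1) / sqrt s ^ 3"
    and "norm (helm'' k s) \<le> (3 + 3 * \<bar>k\<bar> * Q + (k * Q)\<^sup>2) / sqrt s ^ 5"
proof -
  define \<rho> where "\<rho> = sqrt s"
  have \<rho>: "0 < \<rho>" "\<rho> \<le> Q"
    using assms(1,2,4) real_sqrt_le_mono[OF assms(3)] by (auto simp: \<rho>_def simp del: real_sqrt_gt_0_iff)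
  have kr: "\<bar>k * \<rho>\<bar> \<le> \<bar>k\<bar> * Q" using \<rho> by (simp add: abs_mult mult_left_mono)
  have pi1: "1 \<le> 4 * pi" "1 \<le> 8 * pi" "1 \<le> 16 * pi" using pi_ge_two by auto
  have frac: "a / (c * d) \<le> A / d" if "a \<le> A" "0 \<le> a" "1 \<le> c" "d > 0" for a A c d :: real
    using that by (intro frac_le) auto
  show "norm (helm k s) \<le> 1 / sqrt s"
    unfolding helm_def \<rho>_def[symmetric] norm_divide norm_exp_i_times norm_of_real
    using frac[of 1 1 "4 * pi" \<rho>] \<rho> pi1 by simp
  have "norm (\<i> * of_real (k * \<rho>) - 1) \<le> \<bar>k\<bar> * Q + 1"
    using kr norm_triangle_ineq4[of "\<i> * of_real (k * \<rho>)" 1] by (simp add: norm_mult abs_mult)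
  then show "norm (helm' k s) \<le> (\<bar>k\<bar> * Q + 1) / sqrt s ^ 3"
    unfolding helm'_def \<rho>_def[symmetric] norm_divide norm_mult[of "exp _"] norm_exp_i_times norm_of_real
    using frac[of _ _ "8 * pi" "\<rho> ^ 3"] \<rho> pi1 by simp
  have "norm (3 - 3 * \<i> * of_real (k * \<rho>) - of_real ((k * \<rho>)\<^sup>2))
      \<le> norm (3::complex) + norm (3 * \<i> * of_real (k * \<rho>)) + norm (of_real ((k * \<rho>)\<^sup>2) :: complex)"
    by (intro order_trans[OF norm_triangle_ineq4] add_mono norm_triangle_ineq4) auto
  also have "\<dots> = 3 + 3 * \<bar>k * \<rho>\<bar> + \<bar>k * \<rho>\<bar>\<^sup>2" by (simp only: norm_mult norm_of_real) simp
  also have "\<dots> \<le> 3 + 3 * (\<bar>k\<bar> * Q) + (\<bar>k\<bar> * Q)\<^sup>2"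
    using kr by (intro add_mono mult_left_mono power_mono) auto
  finally have "norm (3 - 3 * \<i> * of_real (k * \<rho>) - of_real ((k * \<rho>)\<^sup>2) :: complex) \<le> 3 + 3 * \<bar>k\<bar> * Q + (k * Q)\<^sup>2"
    by (simp add: power_mult_distrib)
  then show "norm (helm'' k s) \<le> (3 + 3 * \<bar>k\<bar> * Q + (k * Q)\<^sup>2) / sqrt s ^ 5"
    unfolding helm''_def \<rho>_def[symmetric] norm_divide norm_mult[of "exp _"] norm_exp_i_times norm_of_real
    using frac[of _ _ "16 * pi" "\<rho> ^ 5"] \<rho> pi1 by simp
qed

section \<open>The kernels in space: derivatives, uniform bounds and integration by parts\<close>

definition reg_green :: "real \<Rightarrow> real \<Rightarrow> 'a::euclidean_space \<Rightarrow> complex" where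
  "reg_green k e z = helm k (e + z \<bullet> z)"

text \<open>Chain rule in direction \<open>h\<close>, the gradient of \<open>z \<bullet> z\<close>
  being \<open>2 z\<close>. Directions instead of gradients match both \<open>has_derivative\<close>
  and \<open>Ck_on\<close>.\<close>

definition reg_green' :: "real \<Rightarrow> real \<Rightarrow> 'a::euclidean_space \<Rightarrow> 'a \<Rightarrow> complex" where
  "reg_green' k e z h = of_real (2 * (z \<bullet> h)) * helm' k (e + z \<bullet> z)"

definition reg_green'' :: "real \<Rightarrow> real \<Rightarrow> 'a::euclidean_space \<Rightarrow> 'a \<Rightarrow> 'a \<Rightarrow> complex" where
  "reg_green'' k e z h h' = of_real (4 * (z \<bullet> h) * (z \<bullet> h')) * helm'' k (e + z \<bullet> z)
     + of_real (2 * (h \<bullet> h')) * helm' k (e + z \<bullet> z)"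

lemma helm_inner_has_derivative:
  fixes z :: "'a::euclidean_space" and F :: "real \<Rightarrow> complex"
  assumes "(F has_vector_derivative F') (at (e + z \<bullet> z))"
  shows "((\<lambda>z. F (e + z \<bullet> z)) has_derivative (\<lambda>h. of_real (2 * (z \<bullet> h)) * F')) (at z)"
proof -
  have "((\<lambda>z. e + z \<bullet> z) has_derivative (\<lambda>h. 2 * (z \<bullet> h))) (at z)"
    by (auto intro!: derivative_eq_intros simp: inner_commute)
  from has_derivative_compose[OF this assms[unfolded has_vector_derivative_def]]
  show ?thesis by (simp add: scaleR_conv_of_real)
qed

lemma reg_green_has_derivative:
  fixes z :: "'a::euclidean_space"
  assumes "e + z \<bullet> z > 0"
  shows "(reg_green k e has_derivative reg_green' k e z) (at z)"
    and "((\<lambda>z. reg_green' k e z h) has_derivative reg_green'' k e z h) (at z)"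
proof -
  show "(reg_green k e has_derivative reg_green' k e z) (at z)"
    unfolding reg_green_def[abs_def] reg_green'_def[abs_def]
    by (rule helm_inner_has_derivative[OF helm_has_vector_derivative[OF assms]])
  have "((\<lambda>z. of_real (2 * (z \<bullet> h)) :: complex) has_derivative (\<lambda>h'. of_real (2 * (h' \<bullet> h)))) (at z)"
    by (auto intro!: derivative_eq_intros)
  from has_derivative_mult[OF this helm_inner_has_derivative[OF helm'_has_vector_derivative[OF assms]]]
  show "((\<lambda>z. reg_green' k e z h) has_derivative reg_green'' k e z h) (at z)"
    unfolding reg_green'_def[abs_def] reg_green''_def[abs_def]
    by (rule has_derivative_eq_rhs) (auto simp: fun_eq_iff inner_commute algebra_simps)
qed

lemma reg_green_continuous:
  fixes S :: "'a::euclidean_space set"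
  assumes "\<And>z. z \<in> S \<Longrightarrow> e + z \<bullet> z > 0"
  shows "continuous_on S (\<lambda>z. reg_green' k e z h)"
    "continuous_on S (\<lambda>z. reg_green'' k e z h h')"
  unfolding reg_green'_def reg_green''_def
  by (intro continuous_intros continuous_on_compose2[OF helm_continuous(2)] continuous_on_compose2[OF helm_continuous(3)];
      use assms in force)+

lemma reg_green_measurable [measurable]:
  "reg_green k e \<in> borel_measurable borel" "(\<lambda>z. reg_green' k e z h) \<in> borel_measurable borel"
  "(\<lambda>z. reg_green'' k e z h h') \<in> borel_measurable borel"
  unfolding reg_green_def reg_green'_def reg_green''_def by measurable

lemma reg_green_tendsto:
  fixes z :: "'a::euclidean_space"
  assumes "z \<noteq> 0" "e \<longlonglongrightarrow> 0"
  shows "(\<lambda>n::nat. reg_green k (e n) z) \<longlonglongrightarrow> reg_green k 0 z"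
    "(\<lambda>n. reg_green' k (e n) z h) \<longlonglongrightarrow> reg_green' k 0 z h"
    "(\<lambda>n. reg_green'' k (e n) z h h') \<longlonglongrightarrow> reg_green'' k 0 z h h'"
proof -
  have lim: "(\<lambda>n. e n + z \<bullet> z) \<longlonglongrightarrow> 0 + z \<bullet> z" by (intro tendsto_intros assms)
  have "isCont F (0 + z \<bullet> z)" if "continuous_on {0<..} F" for F :: "real \<Rightarrow> complex"
    using that assms(1) by (simp add: continuous_on_eq_continuous_at)
  then have "(\<lambda>n. F (e n + z \<bullet> z)) \<longlonglongrightarrow> F (0 + z \<bullet> z)" if "continuous_on {0<..} F" for F :: "real \<Rightarrow> complex"
    using that lim isCont_tendsto_compose by blast
  note L = this[OF helm_continuous(1)] this[OF helm_continuous(2)] this[OF helm_continuous(3)]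
  show "(\<lambda>n. reg_green k (e n) z) \<longlonglongrightarrow> reg_green k 0 z"
    "(\<lambda>n. reg_green' k (e n) z h) \<longlonglongrightarrow> reg_green' k 0 z h"
    "(\<lambda>n. reg_green'' k (e n) z h h') \<longlonglongrightarrow> reg_green'' k 0 z h h'"
    unfolding reg_green_def reg_green'_def reg_green''_def by (intro tendsto_intros L)+
qed

text \<open>The root of \<open>e + z \<bullet> z\<close> is at least \<open>norm z\<close>, so its
  inverse powers are dominated uniformly in \<open>e\<close>. Each factor
  \<open>z \<bullet> h\<close> gives one power of \<open>norm z\<close> back.\<close>

lemma reg_green_bound:
  obtains C where "\<And>e z::'a::euclidean_space. 0 \<le> e \<Longrightarrow> e \<le> 1 \<Longrightarrow> z \<noteq> 0 \<Longrightarrow> norm z \<le> R \<Longrightarrow>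
      norm (reg_green k e z) \<le> norm z powr (-1)"
    and "\<And>e z h::'a. 0 \<le> e \<Longrightarrow> e \<le> 1 \<Longrightarrow> z \<noteq> 0 \<Longrightarrow> norm z \<le> R \<Longrightarrow>
      norm (reg_green' k e z h) \<le> C * norm h * norm z powr (-2)"
    and "\<And>e z h h'::'a. 0 \<le> e \<Longrightarrow> e \<le> 1 \<Longrightarrow> z \<noteq> 0 \<Longrightarrow> norm z \<le> R \<Longrightarrow>
      norm (reg_green'' k e z h h') \<le> C * norm h * norm h' * norm z powr (-3)"
proof -
  \<comment> \<open>An upper bound for the root of \<open>e + z \<bullet> z\<close>, since
    \<open>e <= 1\<close> and \<open>norm z <= R\<close>.\<close>
  define Q where "Q = sqrt (1 + R\<^sup>2)"
  define C1 where "C1 = \<bar>k\<bar> * Q + 1"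
  define C2 where "C2 = 3 + 3 * \<bar>k\<bar> * Q + (k * Q)\<^sup>2"
  have Q: "Q \<ge> 0" by (simp add: Q_def)
  have C: "C1 \<ge> 0" "C2 \<ge> 0" using Q by (auto simp: C1_def C2_def)
  show thesis
  \<comment> \<open>The two terms of \<open>reg_green''\<close> contribute \<open>4 * C2\<close> and
    \<open>2 * C1\<close>; the sum also dominates the constant \<open>2 * C1\<close> of
    \<open>reg_green'\<close>.\<close>
  proof (rule that[of "4 * C2 + 2 * C1"])
    fix e :: real and z h h' :: 'a
    assume e: "0 \<le> e" "e \<le> 1" and z: "z \<noteq> 0" "norm z \<le> R"
    define s where "s = e + z \<bullet> z"
    define \<rho> where "\<rho> = sqrt s"
    have r0: "norm z > 0" using z by simp
    have r1: "norm z \<le> \<rho>" unfolding \<rho>_def s_def norm_eq_sqrt_inner using e by simp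
    have "(norm z)\<^sup>2 \<le> R\<^sup>2" using z by (intro power_mono) auto
    then have sQ: "s \<le> Q\<^sup>2" using e by (simp add: s_def Q_def power2_norm_eq_inner)
    note b = norm_helm_le[OF r0 r1[unfolded \<rho>_def] sQ Q, of k, folded C1_def C2_def \<rho>_def]
    have rho: "\<rho> > 0" using r0 r1 by linarith
    have inv: "1 / \<rho> ^ m \<le> 1 / norm z ^ m" for m
      using r0 r1 rho by (intro divide_left_mono power_mono mult_pos_pos zero_less_power) auto
    show "norm (reg_green k e z) \<le> norm z powr (-1)"
      using b(1) inv[of 1] r0 by (simp add: reg_green_def s_def[symmetric] powr_minus_divide)
    have h1: "norm (helm' k s) \<le> C1 / norm z ^ 3"
      using b(2) mult_left_mono[OF inv[of 3] C(1)] by simp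
    have h2: "norm (helm'' k s) \<le> C2 / norm z ^ 5"
      using b(3) mult_left_mono[OF inv[of 5] C(2)] by simp
    have "norm (reg_green' k e z h) = 2 * \<bar>z \<bullet> h\<bar> * norm (helm' k s)"
      by (simp add: reg_green'_def s_def norm_mult)
    also have "\<dots> \<le> 2 * (norm z * norm h) * (C1 / norm z ^ 3)"
      using h1 C by (intro mult_mono Cauchy_Schwarz_ineq2) auto
    also have "\<dots> = (2 * C1) * norm h * norm z powr (-2)"
      using r0 by (simp add: powr_minus_divide power2_eq_square power3_eq_cube)
    also have "\<dots> \<le> (4 * C2 + 2 * C1) * norm h * norm z powr (-2)"
      using C by (intro mult_right_mono) auto
    finally show "norm (reg_green' k e z h) \<le> (4 * C2 + 2 * C1) * norm h * norm z powr (-2)" .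
    have "norm (reg_green'' k e z h h') \<le> 4 * \<bar>z \<bullet> h\<bar> * \<bar>z \<bullet> h'\<bar> * norm (helm'' k s) + 2 * \<bar>h \<bullet> h'\<bar> * norm (helm' k s)"
      unfolding reg_green''_def s_def[symmetric]
      by (rule order_trans[OF norm_triangle_ineq]) (simp add: norm_mult abs_mult)
    also have "\<dots> \<le> 4 * (norm z * norm h) * (norm z * norm h') * (C2 / norm z ^ 5)
        + 2 * (norm h * norm h') * (C1 / norm z ^ 3)"
      using h1 h2 C by (intro add_mono mult_mono Cauchy_Schwarz_ineq2) auto
    also have "\<dots> = (4 * C2 + 2 * C1) * norm h * norm h' * norm z powr (-3)"
      using r0 by (simp add: powr_minus_divide power3_eq_cube eval_nat_numeral field_simps)
    finally show "norm (reg_green'' k e z h h') \<le> (4 * C2 + 2 * C1) * norm h * norm h' * norm z powr (-3)" .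
  qed
qed

text \<open>A convolution can be differentiated through either factor, and uniqueness of the
  derivative equates the results. No minus sign appears since both derivatives are taken in
  \<open>x\<close>. As \<open>K\<close> need not be integrable, it is cut off to \<open>L\<close>
  when it plays the part of the density.\<close>

lemma convolution_by_parts:
  fixes K \<psi> :: "'a::euclidean_space \<Rightarrow> complex"
  assumes K: "\<And>z. (K has_derivative K' z) (at z)" "\<And>h. continuous_on UNIV (\<lambda>z. K' z h)"
    and \<psi>: "\<And>z. (\<psi> has_derivative \<psi>' z) (at z)" "\<And>h. continuous_on UNIV (\<lambda>z. \<psi>' z h)"
    and supp: "\<And>y. norm y > R \<Longrightarrow> \<psi> y = 0" "\<And>y h. norm y > R \<Longrightarrow> \<psi>' y h = 0"
  shows "(\<integral>y. K' (x - y) h * \<psi> y \<partial>lborel) = (\<integral>y. K (x - y) * \<psi>' y h \<partial>lborel)"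
proof -
  have cont: "continuous_on UNIV K" "continuous_on UNIV \<psi>"
    using K(1) \<psi>(1) has_derivative_continuous by (force simp: continuous_on_eq_continuous_at)+
  then have [measurable]: "K \<in> borel_measurable borel" "\<psi> \<in> borel_measurable borel"
    by (auto intro: borel_measurable_continuous_onI)
  have [measurable]: "(\<lambda>z. \<psi>' z h) \<in> borel_measurable borel" for h
    using \<psi>(2) by (auto intro: borel_measurable_continuous_onI)
  \<comment> \<open>The margin 1 makes the cut-off invisible on all of \<open>ball x 1\<close>;
    comparing derivatives at \<open>x\<close> requires equality in a neighbourhood.\<close>
  define r where "r = norm x + 1 + R"
  define L where "L z = indicator (cball 0 r) z *\<^sub>R K z" for z
  have int: "integrable lborel (\<lambda>z. indicator (cball 0 \<rho>) z *\<^sub>R F z)" if "continuous_on UNIV F" for F :: "'a \<Rightarrow> complex" and \<rho>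
    by (rule borel_integrable_compact[OF compact_cball continuous_on_subset[OF that]]) simp
  have intL: "integrable lborel L"
    unfolding L_def by (rule int[OF cont(1)])
  have "\<psi> = (\<lambda>z. indicator (cball 0 R) z *\<^sub>R \<psi> z)"
    using supp(1) by (auto simp: fun_eq_iff indicator_def)
  then have int\<psi>: "integrable lborel \<psi>" using int[OF cont(2)] by metis
  have L0: "norm z > r \<Longrightarrow> L z = 0" for z by (simp add: L_def)
  have A: "((\<lambda>x. \<integral>y. K (x - y) * \<psi> y \<partial>lborel) has_derivative (\<lambda>h. \<integral>y. K' (x - y) h * \<psi> y \<partial>lborel)) (at x)"
    by (rule has_derivative_convolution[OF K int\<psi> supp(1)])
  have B: "((\<lambda>x. \<integral>y. \<psi> (x - y) * L y \<partial>lborel) has_derivative (\<lambda>h. \<integral>y. \<psi>' (x - y) h * L y \<partial>lborel)) (at x)"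
    by (rule has_derivative_convolution[OF \<psi> intL L0])
  have out: "norm (x' - z) > R" if "x' \<in> ball x 1" "\<not> norm z \<le> r" for x' z
  proof -
    have "norm z \<le> norm (x' - z) + norm x'" using norm_triangle_sub[of z x'] by (simp add: norm_minus_commute)
    moreover have "norm x' \<le> norm x + 1"
      using that(1) norm_triangle_sub[of x' x] by (simp add: dist_norm norm_minus_commute)
    ultimately show ?thesis using that(2) by (simp add: r_def)
  qed
  have "(\<integral>y. \<psi> (x' - y) * L y \<partial>lborel) = (\<integral>y. K (x' - y) * \<psi> y \<partial>lborel)" if "x' \<in> ball x 1" for x'
  proof -
    have "(\<integral>y. \<psi> (x' - y) * L y \<partial>lborel) = (\<integral>y. K y * \<psi> (x' - y) \<partial>lborel)"
      using out[OF that] supp(1) by (intro Bochner_Integration.integral_cong) (auto simp: L_def indicator_def)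
    also have "\<dots> = (\<integral>y. K (x' - y) * \<psi> (x' - (x' - y)) \<partial>lborel)"
      by (rule integral_lborel_minus[symmetric]) measurable
    finally show ?thesis by simp
  qed
  from has_derivative_transform_within_open[OF B open_ball centre_in_ball[THEN iffD2, OF zero_less_one] this]
  have "((\<lambda>x. \<integral>y. K (x - y) * \<psi> y \<partial>lborel) has_derivative (\<lambda>h. \<integral>y. \<psi>' (x - y) h * L y \<partial>lborel)) (at x)"
    by simp
  from has_derivative_unique[OF A this]
  have "(\<integral>y. K' (x - y) h * \<psi> y \<partial>lborel) = (\<integral>y. \<psi>' (x - y) h * L y \<partial>lborel)" by metis
  also have "\<dots> = (\<integral>y. K y * \<psi>' (x - y) h \<partial>lborel)"
    using out[of x] supp(2) by (intro Bochner_Integration.integral_cong) (auto simp: L_def indicator_def)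
  also have "\<dots> = (\<integral>y. K (x - y) * \<psi>' (x - (x - y)) h \<partial>lborel)"
    by (rule integral_lborel_minus[symmetric]) measurable
  finally show ?thesis by simp
qed

section \<open>A bump function\<close>

text \<open>Squaring the positive part makes the function C^1 across the sphere of radius \<delta>,
  with bounds explicit in \<delta>.\<close>

definition bump :: "'a::euclidean_space \<Rightarrow> real \<Rightarrow> 'a \<Rightarrow> real" where
  "bump p \<delta> y = (max 0 (\<delta>\<^sup>2 - (norm (y - p))\<^sup>2))\<^sup>2"

definition bump' :: "'a::euclidean_space \<Rightarrow> real \<Rightarrow> 'a \<Rightarrow> 'a \<Rightarrow> real" where
  "bump' p \<delta> y h = - 4 * max 0 (\<delta>\<^sup>2 - (norm (y - p))\<^sup>2) * ((y - p) \<bullet> h)"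

lemma max_square_has_derivative:
  "((\<lambda>t::real. (max 0 t)\<^sup>2) has_real_derivative 2 * max 0 t) (at t)"
proof -
  consider "t > 0" | "t < 0" | "t = 0" by linarith
  then show ?thesis
  proof cases
    case 1
    have "((\<lambda>t. t\<^sup>2) has_real_derivative 2 * max 0 t) (at t)"
      using 1 by (auto intro!: derivative_eq_intros)
    then show ?thesis
      by (rule has_field_derivative_transform_within_open[where S="{0<..}"]) (use 1 in auto)
  next
    case 2
    have "((\<lambda>t. 0) has_real_derivative 2 * max 0 t) (at t)"
      using 2 by (auto intro!: derivative_eq_intros)
    then show ?thesis
      by (rule has_field_derivative_transform_within_open[where S="{..<0}"]) (use 2 in auto)
  next
    case 3
    \<comment> \<open>The quotient equals \<open>h\<close> on the positive side and 0 on the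
      negative side.\<close>
    have "((\<lambda>h::real. (max 0 h)\<^sup>2 / h) \<longlongrightarrow> 0) (at 0)"
    proof (rule Lim_null_comparison)
      show "\<forall>\<^sub>F h::real in at 0. norm ((max 0 h)\<^sup>2 / h) \<le> norm h"
        by (auto simp: power2_eq_square max_def intro!: always_eventually)
      show "((\<lambda>h::real. norm h) \<longlongrightarrow> 0) (at 0)" by (intro tendsto_norm_zero tendsto_ident_at)
    qed
    then show ?thesis using 3 by (simp add: DERIV_def)
  qed
qed

lemma bump_has_derivative: "(bump p \<delta> has_derivative bump' p \<delta> y) (at y)"
proof -
  have "((\<lambda>y. \<delta>\<^sup>2 - (y - p) \<bullet> (y - p)) has_derivative (\<lambda>h. - 2 * ((y - p) \<bullet> h))) (at y)"
    by (auto intro!: derivative_eq_intros simp: inner_commute)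
  from has_derivative_compose[OF this max_square_has_derivative[unfolded has_field_derivative_def]]
  show ?thesis
    unfolding bump_def[abs_def] bump'_def[abs_def] power2_norm_eq_inner
    by (rule has_derivative_eq_rhs) (auto simp: fun_eq_iff)
qed

lemma bump'_continuous: "continuous_on S (\<lambda>y. bump' p \<delta> y h)"
  unfolding bump'_def by (intro continuous_intros)

lemma bump_outside:
  assumes "\<delta> \<ge> 0" "y \<notin> ball p \<delta>"
  shows "bump p \<delta> y = 0" "bump' p \<delta> y h = 0"
proof -
  have "\<delta>\<^sup>2 \<le> (norm (y - p))\<^sup>2"
    using assms by (intro power_mono) (auto simp: dist_norm norm_minus_commute)
  then show "bump p \<delta> y = 0" "bump' p \<delta> y h = 0" by (auto simp: bump_def bump'_def)
qed

text \<open>The lower bound on the half ball permits division by the bump: there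
  \<open>\<delta>\<^sup>2 - (norm (y - p))\<^sup>2\<close> is at least half of
  \<open>\<delta>\<^sup>2\<close>, and squaring gives the quarter.\<close>

lemma bump_bounds:
  assumes "\<delta> > 0"
  shows "\<bar>bump p \<delta> y\<bar> \<le> \<delta> ^ 4" "\<bar>bump' p \<delta> y h\<bar> \<le> 4 * \<delta> ^ 3 * norm h"
    "y \<in> ball p (\<delta> / 2) \<Longrightarrow> bump p \<delta> y \<ge> \<delta> ^ 4 / 4"
proof -
  define q where "q = max 0 (\<delta>\<^sup>2 - (norm (y - p))\<^sup>2)"
  have q: "0 \<le> q" "q \<le> \<delta>\<^sup>2" by (auto simp: q_def)
  then have "q\<^sup>2 \<le> (\<delta>\<^sup>2)\<^sup>2" by (intro power_mono)
  then show "\<bar>bump p \<delta> y\<bar> \<le> \<delta> ^ 4" by (simp add: bump_def q_def)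
  show "\<bar>bump' p \<delta> y h\<bar> \<le> 4 * \<delta> ^ 3 * norm h"
  proof (cases "y \<in> ball p \<delta>")
    case True
    then have "norm (y - p) \<le> \<delta>" by (simp add: dist_norm norm_minus_commute)
    then have "\<bar>(y - p) \<bullet> h\<bar> \<le> \<delta> * norm h"
      using Cauchy_Schwarz_ineq2[of "y - p" h] by (meson mult_right_mono norm_ge_zero order_trans)
    then have "4 * q * \<bar>(y - p) \<bullet> h\<bar> \<le> 4 * \<delta>\<^sup>2 * (\<delta> * norm h)"
      using q by (intro mult_mono) auto
    moreover have "\<bar>bump' p \<delta> y h\<bar> = 4 * q * \<bar>(y - p) \<bullet> h\<bar>"
      using q by (simp add: bump'_def q_def[symmetric] abs_mult)
    ultimately show ?thesis by (simp add: power2_eq_square power3_eq_cube mult.assoc)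
  qed (use assms in \<open>simp add: bump_outside\<close>)
  assume "y \<in> ball p (\<delta> / 2)"
  then have "(norm (y - p))\<^sup>2 \<le> (\<delta> / 2)\<^sup>2"
    by (intro power_mono) (auto simp: dist_norm norm_minus_commute)
  then have "\<delta>\<^sup>2 / 2 \<le> \<delta>\<^sup>2 - (norm (y - p))\<^sup>2"
    using zero_le_power2[of "norm (y - p)"] unfolding power_divide power2_eq_square[of 2] by linarith
  then have "\<delta>\<^sup>2 / 2 \<le> q" unfolding q_def by (rule max.coboundedI2)
  then have "(\<delta>\<^sup>2 / 2)\<^sup>2 \<le> q\<^sup>2" by (intro power_mono) auto
  then show "bump p \<delta> y \<ge> \<delta> ^ 4 / 4" by (simp add: bump_def q_def power_divide)
qed

lemma bump_lipschitz:
  assumes "\<delta> > 0"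
  shows "\<bar>bump p \<delta> x - bump p \<delta> y\<bar> \<le> 4 * \<delta> ^ 3 * norm (x - y)"
proof -
  have "norm (bump p \<delta> x - bump p \<delta> y) \<le> 4 * \<delta> ^ 3 * norm (x - y)"
    by (rule differentiable_bound[of UNIV _ "bump' p \<delta>"])
       (use bump_has_derivative bump_bounds(2)[OF assms] in \<open>auto intro!: onorm_le\<close>)
  then show ?thesis by simp
qed

text \<open>Write \<open>d\<close> as \<open>d powr (1 - \<alpha>) * d powr \<alpha>\<close> and
  bound the first factor by the diameter \<open>D\<close>.\<close>

lemma lipschitz_imp_holder_bound:
  fixes L d D :: real
  assumes "0 \<le> d" "d \<le> D" "0 < \<alpha>" "\<alpha> \<le> 1" "L \<ge> 0"
  shows "L * d \<le> L * D powr (1 - \<alpha>) * d powr \<alpha>"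
proof -
  have "d = d powr (1 - \<alpha>) * d powr \<alpha>" using assms by (simp flip: powr_add)
  also have "\<dots> \<le> D powr (1 - \<alpha>) * d powr \<alpha>"
    using assms by (intro mult_right_mono powr_mono2) auto
  finally show ?thesis using assms(5) by (simp add: mult_left_mono mult.assoc)
qed

text \<open>The singular integrals run over all \<open>y\<close>, so a Hoelder bound near
  \<open>p\<close> has to become global in \<open>y\<close>. Outside \<open>ball p \<delta>\<close>
  the distance to \<open>x\<close> is at least \<open>\<delta> / 2\<close>, and a multiple of
  \<open>norm (x - y) powr \<alpha>\<close> absorbs the trivial bound \<open>2 * M\<close>.\<close>

lemma local_holder_bounded:
  fixes f :: "'a::real_normed_vector \<Rightarrow> 'b::real_normed_vector"
  assumes "0 < \<alpha>" "\<delta> > 0" "\<And>y. norm (f y) \<le> M" "x \<in> ball p (\<delta> / 2)"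
    and "\<And>x y. x \<in> ball p \<delta> \<Longrightarrow> y \<in> ball p \<delta> \<Longrightarrow> norm (f x - f y) \<le> H * norm (x - y) powr \<alpha>"
  shows "norm (f x - f y) \<le> (\<bar>H\<bar> + 2 * M * (2 / \<delta>) powr \<alpha>) * norm (x - y) powr \<alpha>"
proof -
  have M: "M \<ge> 0" using assms(3) norm_ge_zero order_trans by blast
  show ?thesis
  proof (cases "y \<in> ball p \<delta>")
    case True
    have "x \<in> ball p \<delta>" using assms by auto
    then have "norm (f x - f y) \<le> H * norm (x - y) powr \<alpha>" using True assms(5) by blast
    also have "\<dots> \<le> (\<bar>H\<bar> + 2 * M * (2 / \<delta>) powr \<alpha>) * norm (x - y) powr \<alpha>"
      using M by (intro mult_right_mono) (auto intro: order_trans[OF abs_ge_self])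
    finally show ?thesis .
  next
    case False
    then have "\<delta> / 2 \<le> norm (x - y)"
      using assms(4) dist_triangle[of p y x] by (auto simp: dist_norm)
    then have "1 powr \<alpha> \<le> (2 / \<delta> * norm (x - y)) powr \<alpha>"
      using assms(1,2) by (intro powr_mono2) (auto simp: field_simps)
    then have 1: "1 \<le> (2 / \<delta>) powr \<alpha> * norm (x - y) powr \<alpha>"
      using assms(2) powr_mult[of "2 / \<delta>" "norm (x - y)" \<alpha>] by (simp only: powr_one_eq_one)
    have "norm (f x - f y) \<le> 2 * M * 1"
      using norm_triangle_ineq4[of "f x" "f y"] assms(3)[of x] assms(3)[of y] by simp
    also have "\<dots> \<le> 2 * M * ((2 / \<delta>) powr \<alpha> * norm (x - y) powr \<alpha>)"
      using M 1 by (intro mult_left_mono) auto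
    also have "\<dots> \<le> (\<bar>H\<bar> + 2 * M * (2 / \<delta>) powr \<alpha>) * norm (x - y) powr \<alpha>"
      by (simp add: distrib_right)
    finally show ?thesis .
  qed
qed

section \<open>The volume potential\<close>

lemma integrable_bounded_support:
  fixes \<phi> :: "'a::euclidean_space \<Rightarrow> complex"
  assumes [measurable]: "\<phi> \<in> borel_measurable borel"
    and "\<And>y. norm (\<phi> y) \<le> M" "\<And>y. norm y > R \<Longrightarrow> \<phi> y = 0"
  shows "integrable lborel \<phi>"
proof (rule Bochner_Integration.integrable_bound)
  show "integrable lborel (\<lambda>y. M * indicator (cball (0::'a) R) y)"
    by (intro integrable_mult_right integrable_real_indicator) (use emeasure_lborel_cball_finite[of "0::'a" R] in auto)
  show "AE y in lborel. norm (\<phi> y) \<le> norm (M * indicator (cball (0::'a) R) y)"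
    using assms(2,3) by (intro AE_I2) (auto simp: indicator_def intro: order_trans[OF _ abs_ge_self])
qed simp

lemma inverse_Suc_props: "inverse (real (Suc n)) > 0" "inverse (real (Suc n)) \<le> 1"
  "(\<lambda>n. inverse (real (Suc n))) \<longlonglongrightarrow> 0"
  using LIMSEQ_inverse_real_of_nat by (auto simp: inverse_le_1_iff)

lemma potential_has_derivative:
  fixes \<phi> :: "real^3 \<Rightarrow> complex"
  assumes \<phi>: "\<phi> \<in> borel_measurable borel" "\<And>y. norm (\<phi> y) \<le> M" "\<And>y. norm y > R \<Longrightarrow> \<phi> y = 0"
  shows "((\<lambda>x. \<integral>y. reg_green k 0 (x - y) * \<phi> y \<partial>lborel) has_derivative
           (\<lambda>h. \<integral>y. reg_green' k 0 (x - y) h * \<phi> y \<partial>lborel)) (at x)" (is ?A)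
    and "continuous_on UNIV (\<lambda>x. \<integral>y. reg_green' k 0 (x - y) h * \<phi> y \<partial>lborel)"
proof -
  define e where "e n = inverse (real (Suc n))" for n
  have e: "e n > 0" "e n \<le> 1" "e \<longlonglongrightarrow> 0" for n using inverse_Suc_props unfolding e_def by auto
  have pos: "e n + z \<bullet> z > 0" for n and z :: "real^3" using e(1)[of n] by (simp add: add_pos_nonneg)
  have int: "integrable lborel \<phi>" using \<phi> by (rule integrable_bounded_support)
  have unif: "uniform_limit (ball x 1) (\<lambda>n x. \<integral>y. reg_green k (e n) (x - y) * \<phi> y \<partial>lborel)
        (\<lambda>x. \<integral>y. reg_green k 0 (x - y) * \<phi> y \<partial>lborel) sequentially"
      "uniform_limit (ball x 1) (\<lambda>n x. \<integral>y. reg_green' k (e n) (x - y) h * \<phi> y \<partial>lborel)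
        (\<lambda>x. \<integral>y. reg_green' k 0 (x - y) h * \<phi> y \<partial>lborel) sequentially" for x h
  proof -
    \<comment> \<open>Seen from \<open>ball x 1\<close>, \<phi> vanishes at all distances beyond
      \<open>r\<close>.\<close>
    define r where "r = norm x + 1 + R"
    obtain C where C: "\<And>e z::real^3. 0 \<le> e \<Longrightarrow> e \<le> 1 \<Longrightarrow> z \<noteq> 0 \<Longrightarrow> norm z \<le> r \<Longrightarrow>
        norm (reg_green k e z) \<le> norm z powr (-1)"
      "\<And>e z h::real^3. 0 \<le> e \<Longrightarrow> e \<le> 1 \<Longrightarrow> z \<noteq> 0 \<Longrightarrow> norm z \<le> r \<Longrightarrow>
        norm (reg_green' k e z h) \<le> C * norm h * norm z powr (-2)"
      using reg_green_bound[of r k] by metis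
    have supp: "\<phi> y = 0" if "x' \<in> ball x 1" "norm (x' - y) > r" for x' y
    proof (rule \<phi>(3))
      have "norm x' \<le> norm x + 1"
        using that(1) norm_triangle_sub[of x' x] by (simp add: dist_norm norm_minus_commute)
      then show "norm y > R" using that(2) norm_triangle_ineq4[of x' y] by (simp add: r_def)
    qed
    show "uniform_limit (ball x 1) (\<lambda>n x. \<integral>y. reg_green k (e n) (x - y) * \<phi> y \<partial>lborel)
        (\<lambda>x. \<integral>y. reg_green k 0 (x - y) * \<phi> y \<partial>lborel) sequentially"
      \<comment> \<open>A merely bounded density has \<open>\<beta> = 0\<close>. The orders 1 of the
        kernel and 2 of its first derivatives are still below 3.\<close>
      by (rule singular_kernel_uniform_limit[where t=1 and \<beta>=0 and R=r and C=1 and M=M and \<Phi>="\<lambda>_. \<phi>"])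
         (use C(1) e \<phi> supp reg_green_tendsto(1) in \<open>auto simp: less_imp_le\<close>)
    show "uniform_limit (ball x 1) (\<lambda>n x. \<integral>y. reg_green' k (e n) (x - y) h * \<phi> y \<partial>lborel)
        (\<lambda>x. \<integral>y. reg_green' k 0 (x - y) h * \<phi> y \<partial>lborel) sequentially"
      by (rule singular_kernel_uniform_limit[where t=2 and \<beta>=0 and R=r and C="C * norm h" and M=M and \<Phi>="\<lambda>_. \<phi>"])
         (use C(2) e \<phi> supp reg_green_tendsto(2) in \<open>auto simp: less_imp_le\<close>)
  qed
  have der: "((\<lambda>x. \<integral>y. reg_green k (e n) (x - y) * \<phi> y \<partial>lborel) has_derivative
      (\<lambda>h. \<integral>y. reg_green' k (e n) (x - y) h * \<phi> y \<partial>lborel)) (at x)" for n x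
    by (rule has_derivative_convolution[OF reg_green_has_derivative(1)[OF pos] reg_green_continuous(1)[OF pos] int \<phi>(3)])
  show ?A
    by (rule has_derivative_uniform_limit[where S="ball x 1" and f="\<lambda>n x. \<integral>y. reg_green k (e n) (x - y) * \<phi> y \<partial>lborel"])
       (use der tendsto_uniform_limitI[OF unif(1)] unif(2) in auto)
  have "isCont (\<lambda>x. \<integral>y. reg_green' k 0 (x - y) h * \<phi> y \<partial>lborel) x" for x
  proof -
    have "continuous_on (ball x 1) (\<lambda>x. \<integral>y. reg_green' k (e n) (x - y) h * \<phi> y \<partial>lborel)" for n
      by (rule continuous_on_subset[OF continuous_convolution[OF reg_green_continuous(1)[OF pos] int \<phi>(3)]]) auto
    then have "continuous_on (ball x 1) (\<lambda>x. \<integral>y. reg_green' k 0 (x - y) h * \<phi> y \<partial>lborel)"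
      by (intro uniform_limit_theorem[OF _ unif(2)] always_eventually allI sequentially_bot)
    then show ?thesis
      using continuous_on_eq_continuous_at[OF open_ball] centre_in_ball zero_less_one by blast
  qed
  then show "continuous_on UNIV (\<lambda>x. \<integral>y. reg_green' k 0 (x - y) h * \<phi> y \<partial>lborel)"
    by (simp add: continuous_on_eq_continuous_at)
qed

text \<open>\<open>T\<close> is obtained as the limit of the second derivatives of the regularised
  potentials, because the formal integral of the second kernel derivative against \<phi> need not
  converge absolutely. The result is confined to the half ball, where the bump stays away from
  zero.\<close>

lemma potential_has_second_derivative:
  fixes \<phi> :: "real^3 \<Rightarrow> complex"
  assumes \<phi>: "\<phi> \<in> borel_measurable borel" "\<And>y. norm (\<phi> y) \<le> M" "\<And>y. norm y > R \<Longrightarrow> \<phi> y = 0"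
    and \<alpha>: "0 < \<alpha>" "\<alpha> \<le> 1" and \<delta>: "\<delta> > 0"
    and holder: "\<And>x y. x \<in> ball p \<delta> \<Longrightarrow> y \<in> ball p \<delta> \<Longrightarrow> norm (\<phi> x - \<phi> y) \<le> H * norm (x - y) powr \<alpha>"
  obtains T where
    "\<And>x h. x \<in> ball p (\<delta> / 2) \<Longrightarrow>
      ((\<lambda>x. \<integral>y. reg_green' k 0 (x - y) h * \<phi> y \<partial>lborel) has_derivative T x h) (at x)"
    "\<And>h h'. continuous_on (ball p (\<delta> / 2)) (\<lambda>x. T x h h')"
proof -
  define e where "e n = inverse (real (Suc n))" for n
  have e: "e n > 0" "e n \<le> 1" "e \<longlonglongrightarrow> 0" for n using inverse_Suc_props unfolding e_def by auto
  have pos: "e n + z \<bullet> z > 0" for n and z :: "real^3" using e(1)[of n] by (simp add: add_pos_nonneg)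
  have M: "M \<ge> 0" using \<phi>(2) norm_ge_zero order_trans by blast
  note [measurable] = \<phi>(1)
  define S where "S = ball p (\<delta> / 2)"
  define \<psi> :: "real^3 \<Rightarrow> complex" where "\<psi> y = of_real (bump p \<delta> y)" for y
  define \<psi>' :: "real^3 \<Rightarrow> real^3 \<Rightarrow> complex" where "\<psi>' y h = of_real (bump' p \<delta> y h)" for y h
  have \<psi>d: "(\<psi> has_derivative \<psi>' y) (at y)" for y
    unfolding \<psi>_def[abs_def] \<psi>'_def[abs_def] by (intro has_derivative_of_real bump_has_derivative)
  have \<psi>'c: "continuous_on A (\<lambda>y. \<psi>' y h)" for h A
    unfolding \<psi>'_def by (intro continuous_intros bump'_continuous)
  have \<psi>c: "continuous_on A \<psi>" for A
    using \<psi>d by (meson continuous_at_imp_continuous_on has_derivative_continuous)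
  have [measurable]: "\<psi> \<in> borel_measurable borel" "(\<lambda>y. \<psi>' y h) \<in> borel_measurable borel" for h
    using \<psi>c \<psi>'c by (auto intro: borel_measurable_continuous_onI)
  \<comment> \<open>Farther than \<open>r\<close> from a point of \<open>S\<close>, both \<phi> and
    the bump vanish; the absolute value covers a negative \<open>R\<close>.\<close>
  define r where "r = norm p + 2 * \<delta> + \<bar>R\<bar>"
  have far: "norm y > R" "y \<notin> ball p \<delta>" if "x \<in> S" "norm (x - y) > r" for x y
  proof -
    have x: "norm (x - p) < \<delta>" using that(1) \<delta> by (simp add: S_def dist_norm norm_minus_commute)
    have "norm (x - y) \<le> norm (x - p) + norm p + norm y"
      using norm_triangle_ineq4[of "x - p" "y - p"] norm_triangle_ineq4[of y p] by simp
    then show "norm y > R" using that(2) x \<delta> by (simp add: r_def)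
    have "norm (x - y) \<le> norm (x - p) + norm (y - p)"
      using norm_triangle_ineq4[of "x - p" "y - p"] by simp
    then have "norm (y - p) \<ge> \<delta>"
      using that(2) x \<delta> norm_ge_zero[of p] abs_ge_zero[of R] unfolding r_def by linarith
    then show "y \<notin> ball p \<delta>" by (simp add: dist_norm norm_minus_commute)
  qed
  \<comment> \<open>Chosen to make \<open>\<Phi> x x = 0\<close>.\<close>
  define c where "c x = \<phi> x / \<psi> x" for x
  define \<Phi> where "\<Phi> x y = \<phi> y - c x * \<psi> y" for x y
  define cm where "cm = M / (\<delta> ^ 4 / 4)"
  have \<psi>x: "norm (\<psi> x) \<ge> \<delta> ^ 4 / 4" if "x \<in> S" for x
    using bump_bounds(3)[OF \<delta>, of x p] that by (simp add: \<psi>_def S_def)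
  have \<psi>0: "\<psi> x \<noteq> 0" if "x \<in> S" for x using \<psi>x[OF that] \<delta> by auto
  have cx: "norm (c x) \<le> cm" if "x \<in> S" for x
    unfolding c_def cm_def norm_divide using \<phi>(2) \<psi>x[OF that] M \<delta> by (intro frac_le) auto
  have \<psi>b: "norm (\<psi> y) \<le> \<delta> ^ 4" for y using bump_bounds(1)[OF \<delta>] by (simp add: \<psi>_def)
  have \<psi>'b: "norm (\<psi>' y h) \<le> 4 * \<delta> ^ 3 * norm h" for y h using bump_bounds(2)[OF \<delta>] by (simp add: \<psi>'_def)
  have \<psi>out: "\<psi> y = 0" "\<psi>' y h = 0" if "y \<notin> ball p \<delta>" for y h
    using bump_outside(1)[of \<delta> y p] bump_outside(2)[of \<delta> y p h] that \<delta> by (auto simp: \<psi>_def \<psi>'_def)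
  have cm: "cm \<ge> 0" using M \<delta> by (simp add: cm_def)
  have holder\<psi>: "norm (\<psi> x - \<psi> y) \<le> (4 * \<delta> ^ 3 * (2 * \<delta>) powr (1 - \<alpha>)) * norm (x - y) powr \<alpha>"
    if "x \<in> ball p \<delta>" "y \<in> ball p \<delta>" for x y
  proof -
    have "norm (x - y) \<le> 2 * \<delta>"
      using that dist_triangle2[of x y p] by (simp add: dist_norm norm_minus_commute)
    with \<delta> have "4 * \<delta> ^ 3 * norm (x - y) \<le> (4 * \<delta> ^ 3 * (2 * \<delta>) powr (1 - \<alpha>)) * norm (x - y) powr \<alpha>"
      by (intro lipschitz_imp_holder_bound \<alpha>) auto
    then show ?thesis
      using bump_lipschitz[OF \<delta>, of p x y] by (simp add: \<psi>_def flip: of_real_diff)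
  qed
  define H2 where "H2 = \<bar>4 * \<delta> ^ 3 * (2 * \<delta>) powr (1 - \<alpha>)\<bar> + 2 * \<delta> ^ 4 * (2 / \<delta>) powr \<alpha>"
  have H2: "norm (\<psi> x - \<psi> y) \<le> H2 * norm (x - y) powr \<alpha>" if "x \<in> S" for x y
    unfolding H2_def by (rule local_holder_bounded[OF \<alpha>(1) \<delta> \<psi>b that[unfolded S_def] holder\<psi>])
  define H1 where "H1 = \<bar>H\<bar> + 2 * M * (2 / \<delta>) powr \<alpha>"
  have H1: "norm (\<phi> x - \<phi> y) \<le> H1 * norm (x - y) powr \<alpha>" if "x \<in> S" for x y
    unfolding H1_def by (rule local_holder_bounded[OF \<alpha>(1) \<delta> \<phi>(2) that[unfolded S_def] holder])
  have \<Phi>b: "norm (\<Phi> x y) \<le> (H1 + cm * H2) * norm (x - y) powr \<alpha>" if "x \<in> S" for x y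
  proof -
    \<comment> \<open>Since \<open>c x * \<psi> x = \<phi> x\<close>, the density becomes a
      combination of two increments, each with a Hoelder bound.\<close>
    have "\<Phi> x y = c x * (\<psi> x - \<psi> y) - (\<phi> x - \<phi> y)"
      using \<psi>0[OF that] by (simp add: \<Phi>_def c_def right_diff_distrib)
    also have "norm \<dots> \<le> norm (c x) * norm (\<psi> x - \<psi> y) + norm (\<phi> x - \<phi> y)"
      using norm_triangle_ineq4 by (metis norm_mult)
    also have "\<dots> \<le> cm * (H2 * norm (x - y) powr \<alpha>) + H1 * norm (x - y) powr \<alpha>"
      using that cm by (intro add_mono mult_mono H1 H2 cx) auto
    finally show ?thesis by (simp add: algebra_simps)
  qed
  define f'' where "f'' n x h h' = (\<integral>y. reg_green'' k (e n) (x - y) h h' * \<phi> y \<partial>lborel)" for n x h h'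
  define T where "T x h h' = (\<integral>y. reg_green'' k 0 (x - y) h h' * \<Phi> x y \<partial>lborel)
     + (\<integral>y. reg_green' k 0 (x - y) h * (c x * \<psi>' y h') \<partial>lborel)" for x h h'
  have int: "integrable lborel \<phi>" using \<phi> by (rule integrable_bounded_support)
  have out0: "\<psi> y = 0" "\<psi>' y h = 0" if "norm y > norm p + \<delta>" for y h
    using \<psi>out[of y] norm_triangle_sub[of y p] that by (auto simp: dist_norm norm_minus_commute)
  have int\<psi>: "integrable lborel \<psi>"
    by (rule integrable_bounded_support[OF _ \<psi>b out0(1)]) measurable
  have split: "f'' n x h h' = (\<integral>y. reg_green'' k (e n) (x - y) h h' * \<Phi> x y \<partial>lborel)
     + (\<integral>y. reg_green' k (e n) (x - y) h * (c x * \<psi>' y h') \<partial>lborel)" if "x \<in> S" for n x h h'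
  proof -
    have i: "integrable lborel (\<lambda>y. reg_green'' k (e n) (x - y) h h' * \<phi> y)"
      "integrable lborel (\<lambda>y. reg_green'' k (e n) (x - y) h h' * \<psi> y)"
      by (rule integrable_convolution[OF reg_green_continuous(2)[OF pos] int \<phi>(3)],
          simp,
          rule integrable_convolution[OF reg_green_continuous(2)[OF pos] int\<psi> out0(1)]) simp
    have "(\<integral>y. reg_green' k (e n) (x - y) h * (c x * \<psi>' y h') \<partial>lborel)
        = c x * (\<integral>y. reg_green' k (e n) (x - y) h * \<psi>' y h' \<partial>lborel)"
      unfolding integral_mult_right_zero[symmetric] by (intro Bochner_Integration.integral_cong) auto
    \<comment> \<open>Read from right to left: the derivative in direction \<open>h'\<close> moves
      from the kernel to the bump, which lowers the order of the singularity from 3 to 2.\<close>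
    also have "(\<integral>y. reg_green' k (e n) (x - y) h * \<psi>' y h' \<partial>lborel)
        = (\<integral>y. reg_green'' k (e n) (x - y) h h' * \<psi> y \<partial>lborel)"
      by (rule convolution_by_parts[OF reg_green_has_derivative(2)[OF pos] reg_green_continuous(2)[OF pos] \<psi>d \<psi>'c out0, symmetric])
    finally have *: "(\<integral>y. reg_green' k (e n) (x - y) h * (c x * \<psi>' y h') \<partial>lborel)
        = (\<integral>y. c x * (reg_green'' k (e n) (x - y) h h' * \<psi> y) \<partial>lborel)" by simp
    have "(\<lambda>y. reg_green'' k (e n) (x - y) h h' * \<Phi> x y) = (\<lambda>y. reg_green'' k (e n) (x - y) h h' * \<phi> y
         - c x * (reg_green'' k (e n) (x - y) h h' * \<psi> y))"
      by (simp add: \<Phi>_def fun_eq_iff algebra_simps)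
    then have "(\<integral>y. reg_green'' k (e n) (x - y) h h' * \<Phi> x y \<partial>lborel)
        = f'' n x h h' - (\<integral>y. c x * (reg_green'' k (e n) (x - y) h h' * \<psi> y) \<partial>lborel)"
      unfolding f''_def by (simp only:) (intro Bochner_Integration.integral_diff i integrable_mult_right)
    then show ?thesis unfolding * by simp
  qed
  obtain C where C: "\<And>e z h::real^3. 0 \<le> e \<Longrightarrow> e \<le> 1 \<Longrightarrow> z \<noteq> 0 \<Longrightarrow> norm z \<le> r \<Longrightarrow>
        norm (reg_green' k e z h) \<le> C * norm h * norm z powr (-2)"
      "\<And>e z h h'::real^3. 0 \<le> e \<Longrightarrow> e \<le> 1 \<Longrightarrow> z \<noteq> 0 \<Longrightarrow> norm z \<le> r \<Longrightarrow>
        norm (reg_green'' k e z h h') \<le> C * norm h * norm h' * norm z powr (-3)"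
    using reg_green_bound[of r k] by metis
  have u1: "uniform_limit S (\<lambda>n x. \<integral>y. reg_green' k (e n) (x - y) h * \<phi> y \<partial>lborel)
        (\<lambda>x. \<integral>y. reg_green' k 0 (x - y) h * \<phi> y \<partial>lborel) sequentially" for h
    by (rule singular_kernel_uniform_limit[where t=2 and \<beta>=0 and R=r and C="C * norm h" and M=M and \<Phi>="\<lambda>_. \<phi>"])
       (use C(1) e \<phi> far(1) reg_green_tendsto(2) in \<open>auto simp: less_imp_le\<close>)
  have u2: "uniform_limit S (\<lambda>n x. \<integral>y. reg_green'' k (e n) (x - y) h h' * \<Phi> x y \<partial>lborel)
        (\<lambda>x. \<integral>y. reg_green'' k 0 (x - y) h h' * \<Phi> x y \<partial>lborel) sequentially" for h h'
  \<comment> \<open>Here the Hoelder bound pays off: the effective order is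
    \<open>3 - \<alpha>\<close>, below the dimension.\<close>
  proof (rule singular_kernel_uniform_limit[where t=3 and \<beta>=\<alpha> and R=r and C="C * norm h * norm h'"])
    show "norm (\<Phi> x y) \<le> (H1 + cm * H2) * norm (x - y) powr \<alpha>" if "x \<in> S" for x y by (rule \<Phi>b[OF that])
    show "\<Phi> x y = 0" if "x \<in> S" "norm (x - y) > r" for x y
      using far[OF that] \<phi>(3) \<psi>out(1) by (simp add: \<Phi>_def)
    show "\<Phi> x \<in> borel_measurable borel" for x unfolding \<Phi>_def by measurable
    show "norm (reg_green'' k (e n) z h h') \<le> C * norm h * norm h' * norm z powr - 3"
      if "z \<noteq> 0" "norm z \<le> r" for n z using C(2) e that by (simp add: less_imp_le)
  qed (use \<alpha> e reg_green_tendsto(3) in auto)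
  have u3: "uniform_limit S (\<lambda>n x. \<integral>y. reg_green' k (e n) (x - y) h * (c x * \<psi>' y h') \<partial>lborel)
        (\<lambda>x. \<integral>y. reg_green' k 0 (x - y) h * (c x * \<psi>' y h') \<partial>lborel) sequentially" for h h'
  proof (rule singular_kernel_uniform_limit[where t=2 and \<beta>=0 and R=r and C="C * norm h"])
    show "norm (c x * \<psi>' y h') \<le> (cm * (4 * \<delta> ^ 3 * norm h')) * norm (x - y) powr 0" if "x \<in> S" "y \<noteq> x" for x y
      using that mult_mono[OF cx[OF that(1)] \<psi>'b[of y h'] cm] by (simp add: norm_mult)
    show "c x * \<psi>' y h' = 0" if "x \<in> S" "norm (x - y) > r" for x y
      using far[OF that] \<psi>out(2) by simp
    show "norm (reg_green' k (e n) z h) \<le> C * norm h * norm z powr - 2"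
      if "z \<noteq> 0" "norm z \<le> r" for n z using C(1) e that by (simp add: less_imp_le)
  qed (use e reg_green_tendsto(2) in auto)
  have u4: "uniform_limit S (\<lambda>n x. f'' n x h h') (\<lambda>x. T x h h') sequentially" for h h'
    unfolding T_def using uniform_limit_add[OF u2 u3]
    by (rule uniform_limit_cong'[THEN iffD1, rotated 2]) (auto simp: split)
  have der: "((\<lambda>x. \<integral>y. reg_green' k (e n) (x - y) h * \<phi> y \<partial>lborel) has_derivative f'' n x h) (at x)" for n x h
    unfolding f''_def
    by (rule has_derivative_convolution[OF reg_green_has_derivative(2)[OF pos] reg_green_continuous(2)[OF pos] int \<phi>(3)])
  have cont: "continuous_on S (\<lambda>x. f'' n x h h')" for n h h'
    unfolding f''_def
    by (rule continuous_on_subset[OF continuous_convolution[OF reg_green_continuous(2)[OF pos] int \<phi>(3)]]) auto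
  show thesis
  proof (rule that[of T])
    show "((\<lambda>x. \<integral>y. reg_green' k 0 (x - y) h * \<phi> y \<partial>lborel) has_derivative T x h) (at x)"
      if "x \<in> ball p (\<delta> / 2)" for x h
      by (rule has_derivative_uniform_limit[where S=S and f="\<lambda>n x. \<integral>y. reg_green' k (e n) (x - y) h * \<phi> y \<partial>lborel"
            and f'="\<lambda>n x. f'' n x h" and g'="\<lambda>x. T x h"])
         (use der tendsto_uniform_limitI[OF u1] u4 that in \<open>auto simp: S_def\<close>)
    show "continuous_on (ball p (\<delta> / 2)) (\<lambda>x. T x h h')" for h h'
      unfolding S_def[symmetric]
      by (rule uniform_limit_theorem[OF always_eventually[OF allI[OF cont]] u4 sequentially_bot])
  qed
qed

section \<open>Classes of differentiable functions\<close>

text \<open>\<open>f' x\<close> agrees with \<open>frechet_derivative f (at x)\<close> only for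
  \<open>x\<close> in \<open>S\<close>, so a congruence rule is required. It is a premise because
  the induction for \<open>Ck_on_cong\<close> uses this rule and supplies it as induction
  hypothesis; \<open>Ck_on_SucI'\<close> then discharges it.\<close>

lemma Ck_on_SucI:
  fixes f :: "'a::euclidean_space \<Rightarrow> 'b::real_normed_vector"
  assumes "\<And>x. x \<in> S \<Longrightarrow> (f has_derivative f' x) (at x)" "\<And>h. Ck_on m S (\<lambda>x. f' x h)"
    and cong: "\<And>f g :: 'a \<Rightarrow> 'b. (\<And>x. x \<in> S \<Longrightarrow> f x = g x) \<Longrightarrow> Ck_on m S f \<Longrightarrow> Ck_on m S g"
  shows "Ck_on (Suc m) S f"
proof -
  have eq: "f' x = frechet_derivative f (at x)" if "x \<in> S" for x
    using assms(1)[OF that] by (rule frechet_derivative_at)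
  have "Ck_on m S (\<lambda>x. frechet_derivative f (at x) h)" for h
    by (rule cong[of "\<lambda>x. f' x h"]) (simp add: eq, rule assms(2))
  then show ?thesis using assms(1) by (auto simp: differentiable_def)
qed

lemma Ck_on_cong:
  assumes "open S"
  shows "(\<And>x. x \<in> S \<Longrightarrow> f x = g x) \<Longrightarrow> Ck_on m S f \<Longrightarrow> Ck_on m S g"
proof (induction m arbitrary: f g)
  case 0
  then show ?case using continuous_on_cong[of S S f g] by simp
next
  case (Suc m)
  show ?case
  proof (rule Ck_on_SucI[OF _ _ Suc.IH])
    fix x assume x: "x \<in> S"
    have "(f has_derivative frechet_derivative f (at x)) (at x)"
      using Suc.prems(2) x frechet_derivative_works by auto
    from has_derivative_transform_within_open[OF this \<open>open S\<close> x Suc.prems(1)]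
    show "(g has_derivative frechet_derivative f (at x)) (at x)" .
  next
    show "Ck_on m S (\<lambda>x. frechet_derivative f (at x) h)" for h using Suc.prems(2) by simp
  qed
qed

lemmas Ck_on_SucI' = Ck_on_SucI[OF _ _ Ck_on_cong]

lemma Ck_on_subset: "Ck_on m S f \<Longrightarrow> T \<subseteq> S \<Longrightarrow> Ck_on m T f"
  by (induction m arbitrary: f) (auto intro: continuous_on_subset)

lemma Ck_on_locally:
  assumes "\<And>x. x \<in> S \<Longrightarrow> \<exists>U. open U \<and> x \<in> U \<and> Ck_on m U f"
  shows "Ck_on m S f"
  using assms
proof (induction m arbitrary: f)
  case 0
  have "isCont f x" if "x \<in> S" for x
    using 0[OF that] continuous_on_eq_continuous_at by auto
  then show ?case by (simp add: continuous_at_imp_continuous_on)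
next
  case (Suc m)
  have "f differentiable (at x)" if "x \<in> S" for x using Suc.prems[OF that] by auto
  moreover have "Ck_on m S (\<lambda>x. frechet_derivative f (at x) h)" for h
  proof (rule Suc.IH)
    fix x assume "x \<in> S"
    then obtain U where "open U" "x \<in> U" "Ck_on (Suc m) U f" using Suc.prems by blast
    then show "\<exists>U. open U \<and> x \<in> U \<and> Ck_on m U (\<lambda>x. frechet_derivative f (at x) h)" by auto
  qed
  ultimately show ?case by simp
qed

lemma Ck_on_add:
  assumes "open S"
  shows "Ck_on m S f \<Longrightarrow> Ck_on m S g \<Longrightarrow> Ck_on m S (\<lambda>x. f x + g x)"
proof (induction m arbitrary: f g)
  case 0
  then show ?case by (simp add: continuous_on_add)
next
  case (Suc m)
  show ?case
  proof (rule Ck_on_SucI'[OF _ _ \<open>open S\<close>])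
    show "((\<lambda>x. f x + g x) has_derivative (\<lambda>h. frechet_derivative f (at x) h + frechet_derivative g (at x) h)) (at x)"
      if "x \<in> S" for x
      using Suc.prems that frechet_derivative_works by (intro has_derivative_add) auto
    show "Ck_on m S (\<lambda>x. frechet_derivative f (at x) h + frechet_derivative g (at x) h)" for h
      using Suc by auto
  qed
qed

section \<open>Hoelder continuity\<close>

lemma holder_on_subset: "holder_on \<alpha> S f \<Longrightarrow> T \<subseteq> S \<Longrightarrow> holder_on \<alpha> T f"
  unfolding holder_on_def by blast

lemma holder_on_cong: "(\<And>x. x \<in> S \<Longrightarrow> f x = g x) \<Longrightarrow> holder_on \<alpha> S f \<Longrightarrow> holder_on \<alpha> S g"
  unfolding holder_on_def by metis

lemma holder_on_imp_bounded:
  assumes "holder_on \<alpha> S f" "bounded S" "\<alpha> \<ge> 0"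
  shows "bounded (f ` S)"
proof (cases "S = {}")
  case False
  then obtain z where z: "z \<in> S" by blast
  obtain C where C: "C \<ge> 0" "\<And>x y. x \<in> S \<Longrightarrow> y \<in> S \<Longrightarrow> dist (f x) (f y) \<le> C * dist x y powr \<alpha>"
    using assms(1) unfolding holder_on_def by blast
  obtain D where D: "\<And>x. x \<in> S \<Longrightarrow> dist z x \<le> D" using assms(2) bounded_any_center by metis
  have "dist (f z) (f x) \<le> C * D powr \<alpha>" if "x \<in> S" for x
    using C(1) D[OF that] assms(3)
    by (intro order_trans[OF C(2)[OF z that]] mult_left_mono powr_mono2) auto
  then show ?thesis unfolding bounded_def by blast
qed simp

lemma holder_on_imp_continuous_on:
  assumes "holder_on \<alpha> S f" "\<alpha> > 0"
  shows "continuous_on S f"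
  unfolding continuous_on_def
proof
  fix x assume x: "x \<in> S"
  obtain C where C: "C \<ge> 0" "\<And>x y. x \<in> S \<Longrightarrow> y \<in> S \<Longrightarrow> dist (f x) (f y) \<le> C * dist x y powr \<alpha>"
    using assms(1) unfolding holder_on_def by blast
  have "((\<lambda>y. C * dist y x powr \<alpha>) \<longlongrightarrow> C * 0) (at x within S)"
    using assms(2) by (intro tendsto_mult tendsto_const tendsto_zero_powrI[where b=\<alpha>])
      (auto intro!: tendsto_eq_intros)
  then have lim: "((\<lambda>y. C * dist y x powr \<alpha>) \<longlongrightarrow> 0) (at x within S)" by simp
  have "((\<lambda>y. dist (f y) (f x)) \<longlongrightarrow> 0) (at x within S)"
    by (rule Lim_null_comparison[OF _ lim]) (use C x in \<open>simp add: eventually_at_filter\<close>)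
  then show "(f \<longlongrightarrow> f x) (at x within S)" using tendsto_dist_iff by blast
qed

lemma holder_on_diff_const: "holder_on \<alpha> S f \<Longrightarrow> holder_on \<alpha> S (\<lambda>x. f x - c :: 'b::real_normed_vector)"
  unfolding holder_on_def by (simp add: dist_norm)

lemma holder_on_mult:
  fixes f g :: "'a::metric_space \<Rightarrow> 'b::real_normed_algebra"
  assumes "holder_on \<alpha> S f" "holder_on \<alpha> S g" "bounded (f ` S)" "bounded (g ` S)"
  shows "holder_on \<alpha> S (\<lambda>x. f x * g x)"
proof -
  obtain C where C: "C \<ge> 0" "\<And>x y. x \<in> S \<Longrightarrow> y \<in> S \<Longrightarrow> norm (f x - f y) \<le> C * dist x y powr \<alpha>"
    using assms(1) unfolding holder_on_def dist_norm by blast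
  obtain D where D: "D \<ge> 0" "\<And>x y. x \<in> S \<Longrightarrow> y \<in> S \<Longrightarrow> norm (g x - g y) \<le> D * dist x y powr \<alpha>"
    using assms(2) unfolding holder_on_def dist_norm by blast
  obtain A where A: "A > 0" "\<And>x. x \<in> S \<Longrightarrow> norm (f x) \<le> A" using assms(3) by (auto simp: bounded_pos)
  obtain B where B: "B > 0" "\<And>x. x \<in> S \<Longrightarrow> norm (g x) \<le> B" using assms(4) by (auto simp: bounded_pos)
  have "norm (f x * g x - f y * g y) \<le> (C * B + A * D) * dist x y powr \<alpha>" if "x \<in> S" "y \<in> S" for x y
  proof -
    have "f x * g x - f y * g y = (f x - f y) * g x + f y * (g x - g y)" by (simp add: algebra_simps)
    also have "norm \<dots> \<le> norm (f x - f y) * norm (g x) + norm (f y) * norm (g x - g y)"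
      by (intro order_trans[OF norm_triangle_ineq] add_mono norm_mult_ineq)
    also have "\<dots> \<le> (C * dist x y powr \<alpha>) * B + A * (D * dist x y powr \<alpha>)"
      using that A B C D by (intro add_mono mult_mono) auto
    finally show ?thesis by (simp add: algebra_simps)
  qed
  then show ?thesis
    unfolding holder_on_def dist_norm using A B C D by (intro exI[of _ "C * B + A * D"]) auto
qed

text \<open>The derivative is bounded on a compact ball, so \<open>f\<close> is Lipschitz there; on
  a set of diameter at most \<open>2 * \<delta>\<close> this implies a Hoelder bound for every
  exponent up to 1.\<close>

lemma C1_locally_holder:
  fixes f :: "'a::euclidean_space \<Rightarrow> 'b::real_normed_vector"
  assumes "Ck_on 1 U f" "open U" "p \<in> U" "0 < \<alpha>" "\<alpha> \<le> 1"
  obtains \<delta> where "\<delta> > 0" "ball p \<delta> \<subseteq> U" "holder_on \<alpha> (ball p \<delta>) f"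
proof -
  obtain \<delta> where \<delta>: "\<delta> > 0" "cball p \<delta> \<subseteq> U" using assms(2,3) open_contains_cball by blast
  define f' where "f' x = frechet_derivative f (at x)" for x
  have der: "(f has_derivative f' x) (at x)" if "x \<in> cball p \<delta>" for x
    using assms(1) that \<delta>(2) frechet_derivative_works[of f "at x"] by (auto simp: f'_def)
  have "continuous_on (cball p \<delta>) (\<lambda>x. f' x h)" for h
    using assms(1) \<delta>(2) by (auto simp: f'_def intro: continuous_on_subset)
  then obtain L where L: "L \<ge> 0" "\<And>z h. z \<in> cball p \<delta> \<Longrightarrow> norm (f' z h) \<le> L * norm h"
    using directional_bound_compact[of "cball p \<delta>" f'] der has_derivative_linear by (metis compact_cball)
  have "norm (f x - f y) \<le> L * norm (x - y)" if "x \<in> ball p \<delta>" "y \<in> ball p \<delta>" for x y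
  proof (rule differentiable_bound[of "cball p \<delta>" f f'])
    show "onorm (f' x) \<le> L" if "x \<in> cball p \<delta>" for x using L that by (intro onorm_le) auto
  qed (use that der in \<open>auto intro: has_derivative_at_withinI\<close>)
  moreover have "norm (x - y) \<le> 2 * \<delta>" if "x \<in> ball p \<delta>" "y \<in> ball p \<delta>" for x y
    using that dist_triangle2[of x y p] by (simp add: dist_norm norm_minus_commute)
  ultimately have "norm (f x - f y) \<le> L * (2 * \<delta>) powr (1 - \<alpha>) * norm (x - y) powr \<alpha>"
    if "x \<in> ball p \<delta>" "y \<in> ball p \<delta>" for x y
    using that L(1) assms(4,5)
    by (intro order_trans[OF _ lipschitz_imp_holder_bound[of "norm (x - y)" "2 * \<delta>" \<alpha> L]]) auto
  then have "holder_on \<alpha> (ball p \<delta>) f"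
    unfolding holder_on_def dist_norm using L(1) by (intro exI[of _ "L * (2 * \<delta>) powr (1 - \<alpha>)"]) auto
  then show thesis using that \<delta> ball_subset_cball by (metis subset_trans)
qed

section \<open>Regularity classes of the potential and of the incident field\<close>

lemma potential_C1:
  fixes \<phi> :: "real^3 \<Rightarrow> complex"
  assumes \<phi>: "\<phi> \<in> borel_measurable borel" "\<And>y. norm (\<phi> y) \<le> M" "\<And>y. norm y > R \<Longrightarrow> \<phi> y = 0"
  shows "Ck_on 1 UNIV (\<lambda>x. \<integral>y. reg_green k 0 (x - y) * \<phi> y \<partial>lborel)"
  unfolding One_nat_def
  by (rule Ck_on_SucI'[OF potential_has_derivative(1)[OF \<phi>] _ open_UNIV])
     (simp_all add: potential_has_derivative(2)[OF \<phi>])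

text \<open>The radius of the Hoelder ball may depend on \<open>p\<close>, because being C^2 is
  checked on half of each ball separately.\<close>

lemma potential_C2:
  fixes \<phi> :: "real^3 \<Rightarrow> complex"
  assumes \<phi>: "\<phi> \<in> borel_measurable borel" "\<And>y. norm (\<phi> y) \<le> M" "\<And>y. norm y > R \<Longrightarrow> \<phi> y = 0"
    and \<alpha>: "0 < \<alpha>" "\<alpha> \<le> 1" and holder: "\<And>p. p \<in> U \<Longrightarrow> \<exists>\<delta>>0. holder_on \<alpha> (ball p \<delta>) \<phi>"
  shows "Ck_on 2 U (\<lambda>x. \<integral>y. reg_green k 0 (x - y) * \<phi> y \<partial>lborel)"
proof (rule Ck_on_locally)
  fix p assume "p \<in> U"
  then obtain \<delta> where \<delta>: "\<delta> > 0" and "holder_on \<alpha> (ball p \<delta>) \<phi>" using holder by blast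
  then obtain H where H: "\<And>x y. x \<in> ball p \<delta> \<Longrightarrow> y \<in> ball p \<delta> \<Longrightarrow> norm (\<phi> x - \<phi> y) \<le> H * norm (x - y) powr \<alpha>"
    unfolding holder_on_def dist_norm by blast
  obtain T where T: "\<And>x h. x \<in> ball p (\<delta> / 2) \<Longrightarrow>
      ((\<lambda>x. \<integral>y. reg_green' k 0 (x - y) h * \<phi> y \<partial>lborel) has_derivative T x h) (at x)"
    "\<And>h h'. continuous_on (ball p (\<delta> / 2)) (\<lambda>x. T x h h')"
    using potential_has_second_derivative[OF \<phi> \<alpha> \<delta> H] by blast
  have "Ck_on 2 (ball p (\<delta> / 2)) (\<lambda>x. \<integral>y. reg_green k 0 (x - y) * \<phi> y \<partial>lborel)"
    unfolding numeral_2_eq_2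
    by (rule Ck_on_SucI'[OF potential_has_derivative(1)[OF \<phi>] Ck_on_SucI'[OF T(1)]])
       (auto intro: T(2))
  then show "\<exists>U. open U \<and> p \<in> U \<and> Ck_on 2 U (\<lambda>x. \<integral>y. reg_green k 0 (x - y) * \<phi> y \<partial>lborel)"
    using \<delta> by (intro exI[of _ "ball p (\<delta> / 2)"]) auto
qed

lemma green_eq_reg_green: "green k x y = reg_green k 0 (x - y)"
  by (simp add: green_def reg_green_def helm_def norm_eq_sqrt_inner)

lemma incident_field_Ck:
  "Ck_on 1 (UNIV - {x0}) (incident_field k x0)" "Ck_on 2 (UNIV - {x0}) (incident_field k x0)"
proof -
  have shift: "((\<lambda>x. f (x - x0)) has_derivative f') (at x)" if "(f has_derivative f') (at (x - x0))"
    for f :: "real^3 \<Rightarrow> complex" and f' x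
  proof -
    have "((\<lambda>x. x - x0) has_derivative (\<lambda>h. h)) (at x)" by (auto intro!: derivative_eq_intros)
    from has_derivative_compose[OF this that] show ?thesis .
  qed
  have pos: "0 + (x - x0) \<bullet> (x - x0) > 0" if "x \<in> UNIV - {x0}" for x using that by simp
  have d1: "(incident_field k x0 has_derivative reg_green' k 0 (x - x0)) (at x)" if "x \<in> UNIV - {x0}" for x
    unfolding incident_field_def[abs_def] green_eq_reg_green
    by (rule shift[OF reg_green_has_derivative(1)[OF pos[OF that]]])
  have d2: "((\<lambda>x. reg_green' k 0 (x - x0) h) has_derivative reg_green'' k 0 (x - x0) h) (at x)" if "x \<in> UNIV - {x0}" for x h
    by (rule shift[OF reg_green_has_derivative(2)[OF pos[OF that]]])
  have c: "continuous_on (UNIV - {x0}) (\<lambda>x. g (x - x0))" if "continuous_on (UNIV - {0}) g"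
    for g :: "real^3 \<Rightarrow> complex"
    by (rule continuous_on_compose2[OF that]) (auto intro!: continuous_intros)
  have pos0: "0 + z \<bullet> z > 0" if "z \<in> UNIV - {0}" for z :: "real^3" using that by simp
  note c = c[OF reg_green_continuous(1)[OF pos0]] c[OF reg_green_continuous(2)[OF pos0]]
  have op: "open (UNIV - {x0})" by (simp add: open_delete)
  show "Ck_on 1 (UNIV - {x0}) (incident_field k x0)"
    unfolding One_nat_def by (rule Ck_on_SucI'[OF d1 _ op]) (use c in auto)
  show "Ck_on 2 (UNIV - {x0}) (incident_field k x0)"
    unfolding numeral_2_eq_2 by (rule Ck_on_SucI'[OF d1 Ck_on_SucI'[OF d2 _ op] op]) (use c in auto)
qed

section \<open>Bootstrapping the regularity of a solution\<close>

text \<open>The potential lemmas work with Borel densities on \<open>lborel\<close>, whereas an L2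
  function is only Lebesgue measurable. Real and imaginary parts are treated separately.\<close>

lemma lebesgue_measurable_ex_borel:
  fixes f :: "'a::euclidean_space \<Rightarrow> complex"
  assumes [measurable]: "f \<in> borel_measurable lebesgue"
  obtains g where "g \<in> borel_measurable borel" "AE x in lebesgue. f x = g x"
proof -
  obtain r where r: "r \<in> borel_measurable lborel" "AE x in lborel. Re (f x) = r x"
    using completion_ex_borel_measurable_real[of "\<lambda>x. Re (f x)" lborel] by auto
  obtain i where i: "i \<in> borel_measurable lborel" "AE x in lborel. Im (f x) = i x"
    using completion_ex_borel_measurable_real[of "\<lambda>x. Im (f x)" lborel] by auto
  show thesis
  proof (rule that[of "\<lambda>x. of_real (r x) + \<i> * of_real (i x)"])
    show "(\<lambda>x. of_real (r x) + \<i> * of_real (i x)) \<in> borel_measurable borel"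
      using r(1) i(1) by simp
    show "AE x in lebesgue. f x = of_real (r x) + \<i> * of_real (i x)"
      using AE_completion[OF r(2)] AE_completion[OF i(2)] by eventually_elim (auto simp: complex_eq_iff)
  qed
qed

text \<open>Completeness of Lebesgue measure passes measurability on to \<open>g\<close>. The
  integrand of \<open>volume_potential\<close>, with the arbitrary values of \<open>k\<close> on the
  faces, will take the place of \<open>g\<close>.\<close>

lemma integral_lebesgue_cong_AE:
  fixes f g :: "'a::euclidean_space \<Rightarrow> complex"
  assumes "f \<in> borel_measurable lebesgue" "AE x in lebesgue. f x = g x"
  shows "integral\<^sup>L lebesgue f = integral\<^sup>L lebesgue g"
  using assms borel_measurable_AE[OF assms] by (intro integral_cong_AE) auto

lemma potential_integrand_measurable:
  fixes \<kappa> w :: "real^3 \<Rightarrow> complex"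
  assumes [measurable]: "\<kappa> \<in> borel_measurable borel" and w: "w \<in> borel_measurable lebesgue"
  shows "(\<lambda>y. \<kappa> y * w y) \<in> borel_measurable lebesgue"
    "(\<lambda>y. reg_green k 0 (x - y) * (\<kappa> y * w y)) \<in> borel_measurable lebesgue"
proof -
  show "(\<lambda>y. \<kappa> y * w y) \<in> borel_measurable lebesgue"
    by (intro borel_measurable_times measurable_completion w) simp
  moreover have "(\<lambda>y. reg_green k 0 (x - y)) \<in> borel_measurable lebesgue"
    by (rule measurable_completion) simp
  ultimately show "(\<lambda>y. reg_green k 0 (x - y) * (\<kappa> y * w y)) \<in> borel_measurable lebesgue"
    by (rule borel_measurable_times[rotated])
qed

text \<open>By |G| |w| <= |G|^2 + |w|^2 it is enough that |G|^2 is at most |z|^-2, which is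
  integrable on balls in dimension 3; translation makes that integral independent of
  \<open>x\<close>. The bound holds at every \<open>x\<close> in \<open>W\<close>, not just almost
  everywhere.\<close>

lemma L2_potential_bounded:
  fixes w \<kappa> :: "real^3 \<Rightarrow> complex"
  assumes W: "bounded W" and w: "integrable lebesgue (\<lambda>y. (norm (w y))\<^sup>2)"
    and \<kappa>: "\<And>y. norm (\<kappa> y) \<le> M" "\<And>y. y \<notin> W \<Longrightarrow> \<kappa> y = 0"
  obtains B where "\<And>x. x \<in> W \<Longrightarrow> norm (\<integral>y. reg_green k 0 (x - y) * (\<kappa> y * w y) \<partial>lebesgue) \<le> B"
proof -
  have M: "M \<ge> 0" using \<kappa>(1) norm_ge_zero order_trans by blast
  obtain R where R: "\<And>x. x \<in> W \<Longrightarrow> norm x \<le> R" using W by (auto simp: bounded_iff)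
  define D where "D = 2 * R"
  define d where "d z = indicator (cball 0 D) z * norm z powr (-2)" for z :: "real^3"
  have intd: "integrable lborel d" unfolding d_def by (rule integrable_norm_powr_ball) auto
  have [measurable]: "d \<in> borel_measurable borel" using intd by simp
  have d0: "d z \<ge> 0" for z by (simp add: d_def)
  obtain C where C: "\<And>e z::real^3. 0 \<le> e \<Longrightarrow> e \<le> 1 \<Longrightarrow> z \<noteq> 0 \<Longrightarrow> norm z \<le> D \<Longrightarrow>
      norm (reg_green k e z) \<le> norm z powr (-1)"
    using reg_green_bound[of D k] by blast
  show thesis
  proof (rule that)
    fix x assume x: "x \<in> W"
    define g where "g y = M * ((norm (w y))\<^sup>2 + d (x - y))" for y
    have intx: "integrable lebesgue (\<lambda>y. d (x - y))"
      using integrable_lborel_minus[OF intd, of x] by (subst integrable_completion) auto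
    have intg: "integrable lebesgue g"
      unfolding g_def by (intro integrable_mult_right Bochner_Integration.integrable_add w intx)
    have g0: "g y \<ge> 0" for y unfolding g_def using M d0 by simp
    have "norm (reg_green k 0 (x - y) * (\<kappa> y * w y)) \<le> g y" for y
    proof (cases "y \<in> W \<and> y \<noteq> x")
      case True
      then have y: "x - y \<noteq> 0" "norm (x - y) \<le> D"
        using R[of x] R[of y] x norm_triangle_ineq4[of x y] by (auto simp: D_def)
      define q where "q = norm (x - y) powr (-1)"
      have "norm (reg_green k 0 (x - y) * (\<kappa> y * w y)) \<le> q * (M * norm (w y))"
        unfolding norm_mult q_def using M y by (intro mult_mono C \<kappa>) auto
      also have "\<dots> \<le> M * ((norm (w y))\<^sup>2 + q\<^sup>2)"
      proof -
        have "0 \<le> (norm (w y) - q)\<^sup>2" "0 \<le> norm (w y) * q" by (auto simp: q_def)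
        then have "norm (w y) * q \<le> (norm (w y))\<^sup>2 + q\<^sup>2" unfolding power2_diff by linarith
        from mult_left_mono[OF this M] show ?thesis by (simp add: mult_ac)
      qed
      also have "q\<^sup>2 = d (x - y)"
      proof -
        have "q\<^sup>2 = norm (x - y) powr (-2)" unfolding q_def power2_eq_square powr_add[symmetric] by simp
        then show ?thesis using y by (simp add: d_def)
      qed
      finally show ?thesis by (simp add: g_def)
    next
      case False
      \<comment> \<open>At \<open>y = x\<close> the kernel is 0, since division by zero yields
        0.\<close>
      then have "reg_green k 0 (x - y) * (\<kappa> y * w y) = 0"
        using \<kappa>(2)[of y] by (auto simp: reg_green_def helm_def)
      then show ?thesis using g0 by (simp only: norm_zero)
    qed
    then have "norm (\<integral>y. reg_green k 0 (x - y) * (\<kappa> y * w y) \<partial>lebesgue) \<le> integral\<^sup>L lebesgue g"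
      by (intro order_trans[OF integral_norm_bound] integral_mono_AE'[OF intg]) (auto simp: g0)
    also have "\<dots> = M * ((\<integral>y. (norm (w y))\<^sup>2 \<partial>lebesgue) + (\<integral>y. d (x - y) \<partial>lebesgue))"
      unfolding g_def using w intx by simp
    also have "(\<integral>y. d (x - y) \<partial>lebesgue) = integral\<^sup>L lborel d"
      by (subst integral_completion) (auto simp: integral_lborel_minus)
    finally show "norm (\<integral>y. reg_green k 0 (x - y) * (\<kappa> y * w y) \<partial>lebesgue)
        \<le> M * ((\<integral>y. (norm (w y))\<^sup>2 \<partial>lebesgue) + integral\<^sup>L lborel d)" .
  qed
qed

text \<open>The geometry of the grid is kept out of the analysis, which sees only open sets with
  bounded union and a coefficient that is Hoelder continuous on each. The integral defines
  \<open>v\<close> at every point; \<open>sol\<close> ties it to \<open>w\<close> almost everywhere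
  in \<open>W\<close>.\<close>

lemma Lippmann_Schwinger_regularity:
  fixes \<U> :: "(real^3) set set" and w \<kappa> :: "real^3 \<Rightarrow> complex" and k :: real and x0 :: "real^3"
  defines "W \<equiv> \<Union>\<U>"
  defines "v \<equiv> \<lambda>x. incident_field k x0 x + (\<integral>y. reg_green k 0 (x - y) * (\<kappa> y * w y) \<partial>lebesgue)"
  assumes \<U>: "\<And>U. U \<in> \<U> \<Longrightarrow> open U" and W: "bounded W" and x0: "x0 \<notin> closure W"
    and w: "w \<in> borel_measurable lebesgue" "integrable lebesgue (\<lambda>y. (norm (w y))\<^sup>2)"
    and \<alpha>: "0 < \<alpha>" "\<alpha> \<le> 1" and holder: "\<And>U. U \<in> \<U> \<Longrightarrow> holder_on \<alpha> U \<kappa>"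
    and \<kappa>: "\<And>y. norm (\<kappa> y) \<le> M" "\<And>y. y \<notin> W \<Longrightarrow> \<kappa> y = 0"
    and \<kappa>m: "\<kappa> \<in> borel_measurable borel"
    and sol: "AE x in lebesgue. x \<in> W \<longrightarrow> w x = v x"
  shows "Ck_on 1 (UNIV - {x0}) v" "\<And>U. U \<in> \<U> \<Longrightarrow> Ck_on 2 U v" "Ck_on 2 (UNIV - (closure W \<union> {x0})) v"
proof -
  have M: "M \<ge> 0" using \<kappa>(1) norm_ge_zero order_trans by blast
  have openW: "open W" using \<U> by (auto simp: W_def)
  have [measurable]: "W \<in> sets borel" using openW by simp
  obtain R where R: "\<And>x. x \<in> W \<Longrightarrow> norm x \<le> R" using W by (auto simp: bounded_iff)
  have openx0: "open (UNIV - {x0})" by (simp add: open_delete)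
  have Wx0: "W \<subseteq> UNIV - {x0}" using x0 closure_subset by auto
  obtain B where B: "\<And>x. x \<in> W \<Longrightarrow> norm (v x) \<le> B"
  proof -
    obtain B1 where B1: "\<And>x. x \<in> W \<Longrightarrow> norm (\<integral>y. reg_green k 0 (x - y) * (\<kappa> y * w y) \<partial>lebesgue) \<le> B1"
      using L2_potential_bounded[where \<kappa>=\<kappa> and k=k, OF W w(2) \<kappa>] by blast
    have "continuous_on (UNIV - {x0}) (incident_field k x0)"
      using incident_field_Ck(1)[of x0 k] openx0
      by (intro continuous_at_imp_continuous_on ballI differentiable_imp_continuous_within) auto
    \<comment> \<open>\<open>x0\<close> lies off the closure of \<open>W\<close>, which is compact,
      so the incident field is bounded there.\<close>
    then have "continuous_on (closure W) (incident_field k x0)"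
      using x0 by (rule_tac continuous_on_subset) auto
    then have "bounded (incident_field k x0 ` closure W)"
      using W by (intro compact_imp_bounded compact_continuous_image) auto
    then obtain B0 where "\<And>x. x \<in> closure W \<Longrightarrow> norm (incident_field k x0 x) \<le> B0"
      by (auto simp: bounded_iff)
    then have "norm (v x) \<le> B0 + B1" if "x \<in> W" for x
      unfolding v_def using that closure_subset[of W] B1
      by (intro order_trans[OF norm_triangle_ineq] add_mono) auto
    then show thesis using that by blast
  qed
  have bound: "norm (\<kappa> y * z) \<le> M * B" if "norm z \<le> B" for y z
    unfolding norm_mult using \<kappa>(1) that M by (intro mult_mono) auto
  text \<open>Two densities are used in turn: first a bounded Borel representative of \<open>\<kappa> w\<close>, and then,
    once \<open>v\<close> is known to be of class \<open>C\<^sup>1\<close>, the function \<open>\<kappa> v\<close>, which is locally Hoelder continuous.\<close>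
  have pot: "v x = incident_field k x0 x + (\<integral>y. reg_green k 0 (x - y) * \<phi> y \<partial>lborel)"
    if [measurable]: "\<phi> \<in> borel_measurable borel" and ae: "AE y in lebesgue. \<kappa> y * w y = \<phi> y" for \<phi> x
  proof -
    have "(\<integral>y. reg_green k 0 (x - y) * (\<kappa> y * w y) \<partial>lebesgue) = (\<integral>y. reg_green k 0 (x - y) * \<phi> y \<partial>lebesgue)"
      by (rule integral_lebesgue_cong_AE[OF potential_integrand_measurable(2)[OF \<kappa>m w(1)]]) (use ae in \<open>eventually_elim, simp\<close>)
    also have "\<dots> = (\<integral>y. reg_green k 0 (x - y) * \<phi> y \<partial>lborel)"
      by (rule integral_completion) simp
    finally show ?thesis by (simp add: v_def)
  qed
  show C1: "Ck_on 1 (UNIV - {x0}) v"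
  proof -
    obtain \<phi>0 where \<phi>0[measurable]: "\<phi>0 \<in> borel_measurable borel" and ae: "AE y in lebesgue. \<kappa> y * w y = \<phi>0 y"
      using lebesgue_measurable_ex_borel[OF potential_integrand_measurable(1)[OF \<kappa>m w(1)]] by blast
    \<comment> \<open>Restriction to \<open>W\<close> and truncation at \<open>M * B\<close>
      preserve agreement with \<open>\<kappa> y * w y\<close> almost everywhere, and make the bound
      valid at every point, as the potential lemmas require.\<close>
    define \<phi> where "\<phi> y = (if y \<in> W \<and> norm (\<phi>0 y) \<le> M * B then \<phi>0 y else 0)" for y
    have \<phi>m: "\<phi> \<in> borel_measurable borel" unfolding \<phi>_def by measurable
    have "AE y in lebesgue. \<kappa> y * w y = \<phi> y"
      using ae sol
    proof eventually_elim
      case (elim y)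
      show ?case
      proof (cases "y \<in> W")
        case True
        then have "norm (\<phi>0 y) \<le> M * B" using elim bound B by metis
        then show ?thesis using elim True by (simp add: \<phi>_def)
      qed (simp add: \<phi>_def \<kappa>(2))
    qed
    note v = pot[OF \<phi>m this]
    \<comment> \<open>The absolute value covers an empty \<open>W\<close>, for which
      \<open>B\<close> may be negative.\<close>
    have MB: "norm (\<phi> y) \<le> \<bar>M * B\<bar>" "norm y > R \<Longrightarrow> \<phi> y = 0" for y
      using R[of y] by (auto simp: \<phi>_def)
    show ?thesis
      using Ck_on_add[OF openx0 incident_field_Ck(1) Ck_on_subset[OF potential_C1[OF \<phi>m MB]]]
      by (simp only: v[abs_def] subset_UNIV)
  qed
  define \<phi> where "\<phi> y = \<kappa> y * v y" for y
  have \<phi>0: "y \<notin> W \<Longrightarrow> \<phi> y = 0" for y using \<kappa>(2) by (simp add: \<phi>_def)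
  have "continuous_on W v"
    using C1 Wx0 by (intro continuous_at_imp_continuous_on ballI differentiable_imp_continuous_within) auto
  then have "(\<lambda>y. \<kappa> y * (indicator W y *\<^sub>R v y)) \<in> borel_measurable borel"
    using \<kappa>m by (intro borel_measurable_times borel_measurable_continuous_on_indicator) auto
  moreover have "\<phi> = (\<lambda>y. \<kappa> y * (indicator W y *\<^sub>R v y))"
    using \<phi>0 by (auto simp: \<phi>_def indicator_def)
  ultimately have \<phi>m: "\<phi> \<in> borel_measurable borel" by simp
  have "AE y in lebesgue. \<kappa> y * w y = \<phi> y"
    using sol
  proof eventually_elim
    case (elim y)
    then show ?case using \<kappa>(2) by (cases "y \<in> W") (auto simp: \<phi>_def)
  qed
  note v = pot[OF \<phi>m this]
  have MB: "norm (\<phi> y) \<le> \<bar>M * B\<bar>" "norm y > R \<Longrightarrow> \<phi> y = 0" for y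
  proof -
    show "norm (\<phi> y) \<le> \<bar>M * B\<bar>"
      using bound[OF B, of y y] \<phi>0[of y] by (cases "y \<in> W") (auto simp: \<phi>_def)
    show "norm y > R \<Longrightarrow> \<phi> y = 0" using R[of y] \<phi>0[of y] by auto
  qed
  have C2: "Ck_on 2 U v" if U: "open U" "U \<subseteq> UNIV - {x0}" "\<And>p. p \<in> U \<Longrightarrow> \<exists>\<delta>>0. holder_on \<alpha> (ball p \<delta>) \<phi>" for U
  proof -
    have "Ck_on 2 U (\<lambda>x. \<integral>y. reg_green k 0 (x - y) * \<phi> y \<partial>lborel)"
      by (rule potential_C2[OF \<phi>m MB \<alpha> U(3)])
    from Ck_on_add[OF U(1) Ck_on_subset[OF incident_field_Ck(2) U(2)] this]
    show ?thesis by (simp only: v[abs_def])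
  qed
  show "Ck_on 2 U v" if U: "U \<in> \<U>" for U
  proof (rule C2)
    show "open U" using \<U> U by blast
    show "U \<subseteq> UNIV - {x0}" using U Wx0 by (auto simp: W_def)
    fix p assume p: "p \<in> U"
    \<comment> \<open>\<kappa> is Hoelder on the whole of \<open>U\<close>, but \<open>v\<close>
      only on small balls around its points; hence the product is treated locally.\<close>
    obtain \<delta> where \<delta>: "\<delta> > 0" "ball p \<delta> \<subseteq> U" "holder_on \<alpha> (ball p \<delta>) v"
      using C1_locally_holder[OF Ck_on_subset[OF C1 \<open>U \<subseteq> UNIV - {x0}\<close>] \<open>open U\<close> p \<alpha>] by blast
    have "holder_on \<alpha> (ball p \<delta>) \<kappa>" using holder[OF U] \<delta>(2) by (rule holder_on_subset)
    then have "holder_on \<alpha> (ball p \<delta>) (\<lambda>y. \<kappa> y * v y)"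
      using \<delta>(3) \<alpha>(1) by (intro holder_on_mult holder_on_imp_bounded[of \<alpha>]) auto
    then show "\<exists>\<delta>>0. holder_on \<alpha> (ball p \<delta>) \<phi>" using \<delta>(1) by (auto simp: \<phi>_def[abs_def])
  qed
  show "Ck_on 2 (UNIV - (closure W \<union> {x0})) v"
  proof (rule C2)
    have "UNIV - (closure W \<union> {x0}) = - closure W \<inter> (UNIV - {x0})" by auto
    then show "open (UNIV - (closure W \<union> {x0}))" using openx0 by (simp only:) (intro open_Int, auto)
    show "UNIV - (closure W \<union> {x0}) \<subseteq> UNIV - {x0}" by auto
    fix p assume "p \<in> UNIV - (closure W \<union> {x0})"
    then obtain \<delta> where \<delta>: "\<delta> > 0" "ball p \<delta> \<subseteq> - closure W"
      using open_contains_ball[of "- closure W"] by auto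
    \<comment> \<open>Away from the closure of \<open>W\<close> the density vanishes nearby, so it
      is Hoelder with constant 0.\<close>
    have "holder_on \<alpha> (ball p \<delta>) \<phi>"
    proof -
      have "\<phi> y = 0" if "y \<in> ball p \<delta>" for y using that \<delta>(2) \<phi>0[of y] closure_subset[of W] by blast
      then show ?thesis unfolding holder_on_def by (intro exI[of _ 0]) auto
    qed
    then show "\<exists>\<delta>>0. holder_on \<alpha> (ball p \<delta>) \<phi>" using \<delta>(1) by blast
  qed
qed

section \<open>The grid of sub-domains\<close>

lemma subdomain_eq_box:
  "subdomain a b n I = box (\<chi> j. node a b n j (I $ j)) (\<chi> j. node a b n j (I $ j + 1))"
  by (auto simp: subdomain_def mem_box_cart)

lemma finite_multi_indices: "finite (multi_indices n)"
proof -
  have "multi_indices n \<subseteq> vec_lambda ` (UNIV \<rightarrow>\<^sub>E {..n - 1})"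
  proof
    fix I assume "I \<in> multi_indices n"
    then have "(\<lambda>j. I $ j) \<in> UNIV \<rightarrow>\<^sub>E {..n - 1}" by (auto simp: multi_indices_def)
    then show "I \<in> vec_lambda ` (UNIV \<rightarrow>\<^sub>E {..n - 1})" by (rule rev_image_eqI) simp
  qed
  then show ?thesis by (rule finite_subset) (intro finite_imageI finite_PiE, auto)
qed

context
  fixes a b :: "real^3" and n :: nat
  assumes ab: "\<And>j. a $ j < b $ j" and n: "n \<ge> 1"
begin

lemma node_less_iff: "node a b n j i < node a b n j i' \<longleftrightarrow> i < i'"
proof -
  have "(b $ j - a $ j) / real n > 0" using ab[of j] n by simp
  then show ?thesis unfolding node_def by (simp only: add_less_cancel_left mult_less_cancel_left_pos of_nat_less_iff)
qed

lemma node_ends: "node a b n j 0 = a $ j" "node a b n j n = b $ j"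
  using n by (auto simp: node_def)

text \<open>In each coordinate a common point forces \<open>i < j + 1\<close> and
  \<open>j < i + 1\<close> for the two indices.\<close>

lemma subdomain_disjoint:
  assumes "x \<in> subdomain a b n I" "x \<in> subdomain a b n J"
  shows "I = J"
proof -
  have "I $ j = J $ j" for j
  proof -
    have "node a b n j (I $ j) < node a b n j (J $ j + 1)" "node a b n j (J $ j) < node a b n j (I $ j + 1)"
      using assms by (auto simp: subdomain_def intro: less_trans)
    then show ?thesis unfolding node_less_iff by simp
  qed
  then show ?thesis by (simp add: vec_eq_iff)
qed

lemma subdomain_subset:
  assumes "I \<in> multi_indices n"
  shows "subdomain a b n I \<subseteq> {x. \<forall>j. a $ j < x $ j \<and> x $ j < b $ j}"
proof
  fix x assume x: "x \<in> subdomain a b n I"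
  have "a $ j < x $ j \<and> x $ j < b $ j" for j
  proof -
    have "I $ j \<le> n - 1" using assms by (simp add: multi_indices_def)
    then have "\<not> I $ j < 0" "\<not> n < I $ j + 1" using n by simp_all
    then have "a $ j \<le> node a b n j (I $ j)" "node a b n j (I $ j + 1) \<le> b $ j"
      unfolding node_ends[of j, symmetric] node_less_iff[of j, symmetric] by simp_all
    moreover have "node a b n j (I $ j) < x $ j" "x $ j < node a b n j (I $ j + 1)"
      using x by (auto simp: subdomain_def)
    ultimately show ?thesis by linarith
  qed
  then show "x \<in> {x. \<forall>j. a $ j < x $ j \<and> x $ j < b $ j}" by blast
qed

text \<open>Uncovered points have some coordinate equal to a node, so they lie on countably many
  hyperplanes.\<close>

lemma subdomains_cover_AE:
  "AE x in lebesgue. (\<forall>j. a $ j < x $ j \<and> x $ j < b $ j) \<longrightarrow> x \<in> (\<Union>I\<in>multi_indices n. subdomain a b n I)"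
proof -
  define N where "N = (\<Union>j. \<Union>i. {x :: real^3. x $ j = node a b n j i})"
  have "negligible {x :: real^3. x $ j = c}" for j c
    unfolding cart_eq_inner_axis by (rule negligible_standard_hyperplane) (simp add: axis_in_Basis_iff)
  then have "negligible N"
    unfolding N_def by (intro negligible_Union negligible_Union_nat) auto
  moreover have "x \<in> (\<Union>I\<in>multi_indices n. subdomain a b n I)"
    if x: "\<forall>j. a $ j < x $ j \<and> x $ j < b $ j" and "x \<notin> N" for x
  proof -
    have "\<exists>i. i \<le> n - 1 \<and> node a b n j i < x $ j \<and> x $ j < node a b n j (i + 1)" for j
    proof -
      define h where "h = (b $ j - a $ j) / real n"
      have h: "h > 0" using ab[of j] n by (simp add: h_def)
      have nd: "node a b n j i = a $ j + h * real i" for i by (simp add: node_def h_def)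
      \<comment> \<open>The index of the cell, closed on the left, that contains the coordinate;
        avoiding \<open>N\<close> makes the left inequality strict, and \<open>x $ j < b $ j\<close>
        gives \<open>i <= n - 1\<close>.\<close>
      define i where "i = nat \<lfloor>(x $ j - a $ j) / h\<rfloor>"
      have "(x $ j - a $ j) / h \<ge> 0" using x h by (simp add: less_imp_le)
      then have "real i \<le> (x $ j - a $ j) / h" "(x $ j - a $ j) / h < real i + 1"
        unfolding i_def by linarith+
      then have "node a b n j i \<le> x $ j" "x $ j < node a b n j (i + 1)"
        using h by (simp_all add: nd field_simps)
      moreover have "x $ j \<noteq> node a b n j i" using \<open>x \<notin> N\<close> by (auto simp: N_def)
      ultimately have *: "node a b n j i < x $ j" "x $ j < node a b n j (i + 1)" by simp_all
      then have "node a b n j i < node a b n j n" using x node_ends(2)[of j] by (metis less_trans)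
      then have "i \<le> n - 1" unfolding node_less_iff by simp
      with * show ?thesis by blast
    qed
    then obtain f where f: "\<And>j. f j \<le> n - 1 \<and> node a b n j (f j) < x $ j \<and> x $ j < node a b n j (f j + 1)"
      by metis
    then have "(\<chi> j. f j) \<in> multi_indices n" "x \<in> subdomain a b n (\<chi> j. f j)"
      by (auto simp: multi_indices_def subdomain_def)
    then show ?thesis by blast
  qed
  ultimately show ?thesis unfolding eventually_ae_filter_negligible by (intro exI[of _ N]) auto
qed

end

text \<open>The witness \<open>v\<close> is the incident field plus the potential, evaluated at
  every point. Inside \<open>P\<close> it is a representative of \<open>u\<close>, outside it is the
  prescribed extension; regularity is asserted of \<open>v\<close> because \<open>u\<close> is
  arbitrary on null sets.\<close>

theorem theorem1:
  fixes a b x0 :: "real^3" and n :: nat and k0 :: real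
    and k u :: "real^3 \<Rightarrow> complex" and P :: "(real^3) set"
  assumes "\<And>j. a $ j < b $ j"
    and "P = {x. \<forall>j. a $ j < x $ j \<and> x $ j < b $ j}"
    and "n \<ge> 1"
    and "piecewise_holder a b n k"
    and "k0 > 0"
    and "x0 \<notin> closure P"
    and "L2_on P u"
    and "AE x in lebesgue. x \<in> P \<longrightarrow>
           u x - volume_potential P k0 k u x = incident_field k0 x0 x"
  shows "\<exists>v. (AE x in lebesgue. x \<in> P \<longrightarrow> v x = total_field P k0 k x0 u x) \<and>
             (\<forall>x. x \<notin> P \<union> {x0} \<longrightarrow> v x = total_field P k0 k x0 u x) \<and>
             Ck_on 1 (UNIV - {x0}) v \<and>
             (\<forall>I\<in>multi_indices n. Ck_on 2 (subdomain a b n I) v) \<and>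
             Ck_on 2 (UNIV - (closure P \<union> {x0})) v"
proof -
  note ab = assms(1) and n = assms(3)
  define \<U> where "\<U> = subdomain a b n ` multi_indices n"
  define W where "W = \<Union>\<U>"
  have boxP: "P = box a b" using assms(2) by (auto simp: mem_box_cart)
  have WP: "W \<subseteq> P" unfolding W_def \<U>_def assms(2) using subdomain_subset[OF ab n] by blast
  have bddW: "bounded W" using WP bounded_box bounded_subset unfolding boxP by blast
  have openU: "open U" if "U \<in> \<U>" for U using that by (auto simp: \<U>_def subdomain_eq_box open_box)
  have openW: "open W" using openU by (auto simp: W_def)
  have clW: "closure W \<subseteq> closure P" using WP by (rule closure_mono)
  have coverP: "AE x in lebesgue. x \<in> P \<longrightarrow> x \<in> W"
    using subdomains_cover_AE[OF ab n] unfolding W_def \<U>_def assms(2) by simp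
  \<comment> \<open>Setting \<kappa> to 0 off the open sub-domains discards the arbitrary values of
    \<open>k\<close> on the faces, so that \<kappa> is Borel measurable.\<close>
  define \<kappa> where "\<kappa> y = (if y \<in> W then (k y)\<^sup>2 - of_real (k0\<^sup>2) else 0)" for y
  define w where "w y = indicator P y *\<^sub>R u y" for y
  have w: "w \<in> borel_measurable lebesgue" "integrable lebesgue (\<lambda>y. (norm (w y))\<^sup>2)"
  proof -
    have "(\<lambda>y. (norm (w y))\<^sup>2) = (\<lambda>y. indicator P y *\<^sub>R (norm (u y))\<^sup>2)"
      by (auto simp: w_def indicator_def)
    then show "w \<in> borel_measurable lebesgue" "integrable lebesgue (\<lambda>y. (norm (w y))\<^sup>2)"
      using assms(7) by (simp_all add: L2_on_def set_borel_measurable_def set_integrable_def w_def[abs_def])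
  qed
  obtain \<alpha> kI where \<alpha>: "0 < \<alpha>" "\<alpha> \<le> 1"
    and kI: "\<And>I. I \<in> multi_indices n \<Longrightarrow> holder_on \<alpha> (subdomain a b n I) (kI I)"
    and k: "\<And>x. x \<in> W \<Longrightarrow> k x = (\<Sum>I\<in>multi_indices n. kI I x * indicator (subdomain a b n I) x)"
    using assms(4) unfolding piecewise_holder_def W_def \<U>_def by blast
  have bddU: "bounded U" if "U \<in> \<U>" for U using bddW that bounded_subset unfolding W_def by blast
  have holder: "holder_on \<alpha> U \<kappa>" if U: "U \<in> \<U>" for U
  proof -
    obtain I where I: "I \<in> multi_indices n" "U = subdomain a b n I" using U by (auto simp: \<U>_def)
    have "k x = kI I x" if "x \<in> U" for x
    proof -
      have "k x = (\<Sum>J\<in>multi_indices n. kI J x * indicator (subdomain a b n J) x)"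
        using that U by (intro k) (auto simp: W_def)
      \<comment> \<open>By disjointness, the indicator of \<open>I\<close> is the only one that is
        nonzero at \<open>x\<close>.\<close>
      also have "\<dots> = (\<Sum>J\<in>multi_indices n. if J = I then kI J x else 0)"
        using that subdomain_disjoint[OF ab n, of x] I by (intro sum.cong refl) (auto simp: indicator_def)
      also have "\<dots> = kI I x" using I(1) finite_multi_indices by simp
      finally show ?thesis .
    qed
    then have hk: "holder_on \<alpha> U k" using kI[OF I(1)] I(2) holder_on_cong[of U "kI I" k \<alpha>] by simp
    have "holder_on \<alpha> U (\<lambda>y. k y * k y - of_real (k0\<^sup>2))"
      using hk bddU[OF U] \<alpha>(1)
      by (intro holder_on_diff_const holder_on_mult holder_on_imp_bounded[of \<alpha>]) auto
    then show ?thesis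
      by (rule holder_on_cong[rotated]) (use U in \<open>auto simp: \<kappa>_def W_def power2_eq_square\<close>)
  qed
  have "bounded (\<Union>U\<in>\<U>. \<kappa> ` U)"
    using holder_on_imp_bounded[OF holder bddU] \<alpha>(1) finite_multi_indices by (auto simp: \<U>_def)
  then obtain M where M: "M > 0" "\<And>y. y \<in> W \<Longrightarrow> norm (\<kappa> y) \<le> M"
    by (auto simp: bounded_pos W_def)
  have \<kappa>b: "norm (\<kappa> y) \<le> M" for y using M by (cases "y \<in> W") (auto simp: \<kappa>_def)
  have \<kappa>0: "\<kappa> y = 0" if "y \<notin> W" for y using that by (simp add: \<kappa>_def)
  have "continuous_on W \<kappa>"
    unfolding W_def using openU holder_on_imp_continuous_on[OF holder \<alpha>(1)]
    by (intro continuous_on_open_Union) auto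
  then have "(\<lambda>y. indicator W y *\<^sub>R \<kappa> y) \<in> borel_measurable borel"
    using openW by (intro borel_measurable_continuous_on_indicator) auto
  moreover have "(\<lambda>y. indicator W y *\<^sub>R \<kappa> y) = \<kappa>" using \<kappa>0 by (auto simp: indicator_def)
  ultimately have \<kappa>m: "\<kappa> \<in> borel_measurable borel" by simp
  define v where "v x = incident_field k0 x0 x + (\<integral>y. reg_green k0 0 (x - y) * (\<kappa> y * w y) \<partial>lebesgue)" for x
  have v: "v x = incident_field k0 x0 x + volume_potential P k0 k u x" for x
  proof -
    \<comment> \<open>The two integrands can differ only at points of \<open>P\<close> outside
      \<open>W\<close>, which \<open>coverP\<close> shows to be null.\<close>
    have "AE y in lebesgue. reg_green k0 0 (x - y) * (\<kappa> y * w y)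
        = indicator P y *\<^sub>R (((k y)\<^sup>2 - of_real (k0\<^sup>2)) * green k0 x y * u y)"
      using coverP
      by eventually_elim (use WP in \<open>auto simp: \<kappa>_def w_def green_eq_reg_green indicator_def\<close>)
    from integral_lebesgue_cong_AE[OF potential_integrand_measurable(2)[OF \<kappa>m w(1)] this]
    show ?thesis by (simp only: v_def volume_potential_def set_lebesgue_integral_def)
  qed
  have sol: "AE x in lebesgue. x \<in> P \<longrightarrow> v x = u x"
    using assms(8) by eventually_elim (auto simp: v algebra_simps)
  then have solW: "AE x in lebesgue. x \<in> W \<longrightarrow> w x = v x"
    by eventually_elim (use WP in \<open>auto simp: w_def\<close>)
  have x0W: "x0 \<notin> closure W" using clW assms(6) by blast
  note reg = Lippmann_Schwinger_regularity[where \<U>=\<U> and w=w and \<kappa>=\<kappa> and k=k0 and ?x0.0=x0 and \<alpha>=\<alpha> and M=M,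
      folded v_def[abs_def] W_def, OF openU bddW x0W w \<alpha> holder \<kappa>b \<kappa>0 \<kappa>m solW[unfolded v_def]]
  show ?thesis
  proof (intro exI[of _ v] conjI)
    show "AE x in lebesgue. x \<in> P \<longrightarrow> v x = total_field P k0 k x0 u x"
      using sol by (simp add: total_field_def)
    show "\<forall>x. x \<notin> P \<union> {x0} \<longrightarrow> v x = total_field P k0 k x0 u x"
      by (simp add: v total_field_def)
    show "Ck_on 1 (UNIV - {x0}) v" by (rule reg(1))
    show "\<forall>I\<in>multi_indices n. Ck_on 2 (subdomain a b n I) v" using reg(2) by (simp add: \<U>_def)
    show "Ck_on 2 (UNIV - (closure P \<union> {x0})) v"
      \<comment> \<open>The closure of \<open>W\<close> lies in that of \<open>P\<close>, so the set
        in \<open>reg(3)\<close> contains the one wanted.\<close>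
      using reg(3) by (rule Ck_on_subset) (use clW in auto)
  qed
qed

end
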